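(* Let $\{x^k\}$ be the (infinite) sequence generated by Algorithm BNL0R (described in the context) with $\tau\in(0,\overline{\tau})$ and $\delta\in(0,\min\{1,\ell_*\})$, and let $x^*$ be one of its accumulation points. Assume that strict complementarity and Abadie's constraint qualification hold at $x^*$. Suppose that $f$ is strongly smooth with constant $L>0$ and locally strongly convex with constant $\ell_*>0$ around $x^*$. Then the following hold. (i) The whole sequence $\{x^k\}$ converges to $x^*$, which is a strict local minimizer of $\min_{x\in\mathbb{R}^n} f(x)+\lambda p(x)$. (ii) The Newton direction is always accepted for sufficiently large $k$; that is, for all sufficiently large $k$ case (NM) of step S2 of the algorithm is used. (iii) If the Hessian of $f$ is locally Lipschitz continuous around $x^*$ with constant $M_*\ge 0$, then for all sufficiently large $k$ $$\|x^{k+1}-x^*\|\le \frac{M_*}{2\tilde{\ell}_*}\,\|x^k-x^*\|^2,\qquad \tilde{\ell}_*:=\min(1,\ell_* ).$$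
   Context: Problem. $f:\mathbb{R}^n\to\mathbb{R}$ is twice continuously differentiable and bounded from below, $\lambda>0$, $l,u\in\mathbb{R}^n_+$, $\Omega:=\{x\in\mathbb{R}^n: -l\le x\le u\}$, $\|x\|_0$ is the number of nonzero entries of $x$, and $p(x):=\|x\|_0+\delta_\Omega(x)$, where $\delta_\Omega$ is $0$ on $\Omega$ and $+\infty$ outside. The problem is $\min_{x} f(x)+\lambda p(x)$. It is assumed throughout that $\nabla f(0)\neq 0$. Notation. $\mathbb{N}_n=\{1,\dots,n\}$; $\overline{\mathcal I}$ is the complement of $\mathcal I$ in $\mathbb{N}_n$; $x_{\mathcal I}$, $\nabla_{\mathcal I}f$, $\nabla^2_{\Theta,\Gamma}f$ are subvectors/submatrices; $\|\cdot\|$ is the $\ell_2$ norm (and the spectral norm for matrices); $\Pi_\Omega$ is the Euclidean projection onto $\Omega$; $\mathrm{supp}(x)$ is the set of indices of nonzero entries of $x$. $f$ is strongly smooth with constant $L>0$ if $f(z)\le f(x)+\langle\nabla f(x),z-x\rangle+\frac L2\|z-x\|^2$ for all $x,z\in\mathbb{R}^n$. $f$ is locally strongly convex with constant $\ell_*>0$ around $x^*$ if $f(z)\ge f(x)+\langle\nabla f(x),z-x\rangle+\frac{\ell_*}{2}\|z-x\|^2$ for all $x,z$ in a neighborhood of $x^*$. The Hessian is locally Lipschitz around $x^*$ with constant $M_*$ if $\|\nabla^2f(x)-\nabla^2f(y)\|\le M_*\|x-y\|$ for all $x,y$ in a neighborhood of $x^*$. Parameters. $\sigma\in(0,1/2)$,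 $\beta\in(0,1)$, $\delta>0$, $a:=\min_{i}\min(l_i^2,u_i^2)$, $\tau>0$ with $\tau<a/(2\lambda)$, and $\lambda\in(0,\underline{\lambda})$, where $\underline{\lambda}:=\min_i\{\frac{\tau}{2}|\nabla_if(0)|^2:\nabla_if(0)\ne0\}$. Moreover $$\overline{\alpha}:=\min\Big\{\tfrac{1-2\sigma}{L/\delta-\sigma},\tfrac{2(1-\sigma)\delta}{L},1\Big\},\qquad \overline{\tau}:=\min\Big\{\tfrac{2\overline{\alpha}\delta\beta}{nL^2},\tfrac{\overline{\alpha}\beta}{n},\tfrac1{4L},\tfrac{2(1-\sigma)}{L},\tfrac{a}{2\lambda},\tfrac{a}{2\max_{i\in\mathbb{N}_n}|\nabla_if(0)|}\Big\}.$$ Index sets. For $x\in\mathbb{R}^n$: $\Theta_\tau(x)=\{i: -l_i<x_i-\tau\nabla_if(x)<u_i,\ |x_i-\tau\nabla_if(x)|\ge\sqrt{2\tau\lambda}\}$, $\Gamma^u_\tau(x)=\{i: x_i-\tau\nabla_if(x)\ge u_i\}$, $\Gamma^l_\tau(x)=\{i:x_i-\tau\nabla_if(x)\le -l_i\}$, $\Gamma_\tau(x)=\Gamma^u_\tau(x)\cup\Gamma^l_\tau(x)$, $\mathcal I_\tau(x)=\Theta_\tau(x)\cup\Gamma_\tau(x)$. At iterate $x^k$ write $\Theta_k=\Theta_\tau(x^k)$, $\Gamma_k=\Gamma_\tau(x^k)$, $\mathcal I_k=\mathcal I_\tau(x^k)$, $g^k=\nabla f(x^k)$. Algorithm BNL0R.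 Start with $x^0\in\Omega$, $\mathcal I_{-1}=\emptyset$, $k=0$. (Termination tests are ignored, so an infinite sequence is produced.) S1. Compute $\Theta_k,\Gamma_k,\mathcal I_k$. S2. (NM) If the Newton system $$\nabla^2_{\Theta_k,\Theta_k}f(x^k)d^k_{\Theta_k}+\nabla^2_{\Theta_k,\Gamma_k}f(x^k)d^k_{\Gamma_k}+\nabla^2_{\Theta_k,\overline{\mathcal I}_k}f(x^k)d^k_{\overline{\mathcal I}_k}=-\nabla_{\Theta_k}f(x^k),$$ $$d^k_{\Gamma_k}=[\Pi_\Omega(x^k-\tau g^k)]_{\Gamma_k}-x^k_{\Gamma_k},\qquad d^k_{\overline{\mathcal I}_k}=-x^k_{\overline{\mathcal I}_k}$$ is solvable and its solution $d^k$ satisfies all of: $\langle g^k_{\mathcal I_k},d^k_{\mathcal I_k}\rangle\le-\delta\|d^k\|^2+\|x^k_{\overline{\mathcal I}_k}\|^2/(4\tau)$; $|\mathcal I_k|\le\|x^k\|_0$; $x^k+d^k\in\Omega$; and ($\Theta_k\setminus\mathcal I_{k-1}\ne\emptyset$ or $\mathcal I_k=\mathcal I_{k-1}$); then use this $d^k$ and go to S3. (PGM) Otherwise set $d^k_{\mathcal I_k}=[\Pi_\Omega(x^k-\tau g^k)]_{\mathcal I_k}-x^k_{\mathcal I_k}$, $d^k_{\overline{\mathcal I}_k}=-x^k_{\overline{\mathcal I}_k}$, $x^{k+1}=x^k+d^k$, and go to S4. S3. Let $\tilde x^k(\alpha)$ be the vector with $\tilde x^k(\alpha)_{\Theta_k}=x^k_{\Theta_k}+\alpha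 d^k_{\Theta_k}$, $\tilde x^k(\alpha)_{\Gamma_k}=x^k_{\Gamma_k}+d^k_{\Gamma_k}$, $\tilde x^k(\alpha)_{\overline{\mathcal I}_k}=0$. Find the smallest integer $m_k\ge0$ with $f(\tilde x^k(\beta^{m_k}))\le f(x^k)+\sigma\beta^{m_k}\langle g^k,d^k\rangle$; set $\alpha_k=\beta^{m_k}$, $x^{k+1}=\tilde x^k(\alpha_k)$. S4. $k\leftarrow k+1$; go to S1. Strict complementarity and Abadie's CQ. In this setting the sets $\mathcal I_k$ are constant for all sufficiently large $k$; $\mathcal I_\infty$ denotes this constant value. Strict complementarity and Abadie's CQ at $x^*$ refer to the problem $\min f(x)$ s.t. $-l_i\le x_i\le u_i$ ($i\in\mathcal I_\infty$), $x_i=0$ ($i\notin\mathcal I_\infty$). With KKT multipliers $\xi_i\ge0$ for $x_i\le u_i$, $\beta_i\ge0$ for $-l_i\le x_i$ ($i\in\mathcal I_\infty$) and $\nu_i\in\mathbb R$ for $x_i=0$ ($i\notin\mathcal I_\infty$), satisfying $\nabla f(x^* )+\xi-\beta+\nu=0$ and complementary slackness, strict complementarity means $\xi_i>0$ whenever $x_i^*=u_i$ and $\beta_i>0$ whenever $x_i^*=-l_i$, $i\in\mathcal I_\infty$. Abadie's CQ means that the tangent cone of the feasible set at $x^*$ equals the linearized cone at $x^*$. *)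

theory Defs
  imports "HOL-Analysis.Analysis"
begin

text \<open>
  Throughout, \<open>g\<close> is the gradient field and \<open>H\<close> the Hessian field of \<open>f\<close>; both are uniquely
  determined by \<open>f\<close> through the first definition below.
\<close>

definition twice_cont_diff ::
    "(real^'n \<Rightarrow> real) \<Rightarrow> (real^'n \<Rightarrow> real^'n) \<Rightarrow> (real^'n \<Rightarrow> real^'n^'n) \<Rightarrow> bool" where
  "twice_cont_diff f g H \<longleftrightarrow>
     (\<forall>x. GDERIV f x :> g x) \<and>
     (\<forall>x. (g has_derivative (\<lambda>h. H x *v h)) (at x)) \<and>
     continuous_on UNIV H"

definition strongly_smooth ::
    "(real^'n \<Rightarrow> real) \<Rightarrow> (real^'n \<Rightarrow> real^'n) \<Rightarrow> real \<Rightarrow> bool" where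
  "strongly_smooth f g L \<longleftrightarrow>
     (\<forall>x z. f z \<le> f x + g x \<bullet> (z - x) + L / 2 * (norm (z - x))\<^sup>2)"

definition locally_strongly_convex ::
    "(real^'n \<Rightarrow> real) \<Rightarrow> (real^'n \<Rightarrow> real^'n) \<Rightarrow> real^'n \<Rightarrow> real \<Rightarrow> bool" where
  "locally_strongly_convex f g xs ell \<longleftrightarrow>
     (\<exists>U. open U \<and> xs \<in> U \<and>
       (\<forall>x\<in>U. \<forall>z\<in>U. f z \<ge> f x + g x \<bullet> (z - x) + ell / 2 * (norm (z - x))\<^sup>2))"

definition hessian_locally_lipschitz ::
    "(real^'n \<Rightarrow> real^'n^'n) \<Rightarrow> real^'n \<Rightarrow> real \<Rightarrow> bool" where
  "hessian_locally_lipschitz H xs M \<longleftrightarrow>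
     (\<exists>U. open U \<and> xs \<in> U \<and>
       (\<forall>x\<in>U. \<forall>y\<in>U. onorm (\<lambda>v. (H x - H y) *v v) \<le> M * norm (x - y)))"


section \<open>The problem\<close>

definition box_set :: "real^'n \<Rightarrow> real^'n \<Rightarrow> (real^'n) set" where
  "box_set l u = {x. \<forall>i. - l $ i \<le> x $ i \<and> x $ i \<le> u $ i}"

definition l0norm :: "real^'n \<Rightarrow> nat" where
  "l0norm x = card {i. x $ i \<noteq> 0}"

definition set_delta :: "'a set \<Rightarrow> 'a \<Rightarrow> ereal" where
  "set_delta S x = (if x \<in> S then 0 else \<infinity>)"

definition penalty :: "real^'n \<Rightarrow> real^'n \<Rightarrow> real^'n \<Rightarrow> ereal" where
  "penalty l u x = ereal (real (l0norm x)) + set_delta (box_set l u) x"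

definition objective ::
    "(real^'n \<Rightarrow> real) \<Rightarrow> real \<Rightarrow> real^'n \<Rightarrow> real^'n \<Rightarrow> real^'n \<Rightarrow> ereal" where
  "objective f lam l u x = ereal (f x) + ereal lam * penalty l u x"

definition strict_local_minimizer :: "('a::metric_space \<Rightarrow> ereal) \<Rightarrow> 'a \<Rightarrow> bool" where
  "strict_local_minimizer F x \<longleftrightarrow> (\<exists>e>0. \<forall>y\<in>ball x e. y \<noteq> x \<longrightarrow> F x < F y)"


section \<open>Parameters\<close>

definition a_const :: "real^'n \<Rightarrow> real^'n \<Rightarrow> real" where
  "a_const l u = Min (range (\<lambda>i. min ((l $ i)\<^sup>2) ((u $ i)\<^sup>2)))"

definition lam_lower :: "(real^'n \<Rightarrow> real^'n) \<Rightarrow> real \<Rightarrow> real" where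
  "lam_lower g \<tau> = Min {\<tau> / 2 * \<bar>g 0 $ i\<bar>\<^sup>2 | i. g 0 $ i \<noteq> 0}"

definition alpha_bar :: "real \<Rightarrow> real \<Rightarrow> real \<Rightarrow> real" where
  "alpha_bar \<sigma> \<delta> L = Min {(1 - 2 * \<sigma>) / (L / \<delta> - \<sigma>), 2 * (1 - \<sigma>) * \<delta> / L, 1}"

definition tau_bar ::
    "(real^'n \<Rightarrow> real^'n) \<Rightarrow> real^'n \<Rightarrow> real^'n \<Rightarrow> real \<Rightarrow> real \<Rightarrow> real \<Rightarrow> real \<Rightarrow> real \<Rightarrow> real" where
  "tau_bar g l u lam \<sigma> \<beta> \<delta> L =
     Min {2 * alpha_bar \<sigma> \<delta> L * \<delta> * \<beta> / (real CARD('n) * L\<^sup>2),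
          alpha_bar \<sigma> \<delta> L * \<beta> / real CARD('n),
          1 / (4 * L),
          2 * (1 - \<sigma>) / L,
          a_const l u / (2 * lam),
          a_const l u / (2 * Max (range (\<lambda>i. \<bar>g 0 $ i\<bar>)))}"


section \<open>Index sets\<close>

definition Theta_set ::
    "(real^'n \<Rightarrow> real^'n) \<Rightarrow> real^'n \<Rightarrow> real^'n \<Rightarrow> real \<Rightarrow> real \<Rightarrow> real^'n \<Rightarrow> 'n set" where
  "Theta_set g l u lam \<tau> x =
     {i. - l $ i < x $ i - \<tau> * g x $ i \<and> x $ i - \<tau> * g x $ i < u $ i \<and>
         \<bar>x $ i - \<tau> * g x $ i\<bar> \<ge> sqrt (2 * \<tau> * lam)}"

definition Gamma_set ::
    "(real^'n \<Rightarrow> real^'n) \<Rightarrow> real^'n \<Rightarrow> real^'n \<Rightarrow> real \<Rightarrow> real^'n \<Rightarrow> 'n set" where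
  "Gamma_set g l u \<tau> x =
     {i. x $ i - \<tau> * g x $ i \<ge> u $ i} \<union> {i. x $ i - \<tau> * g x $ i \<le> - l $ i}"

definition I_set ::
    "(real^'n \<Rightarrow> real^'n) \<Rightarrow> real^'n \<Rightarrow> real^'n \<Rightarrow> real \<Rightarrow> real \<Rightarrow> real^'n \<Rightarrow> 'n set" where
  "I_set g l u lam \<tau> x = Theta_set g l u lam \<tau> x \<union> Gamma_set g l u \<tau> x"


section \<open>The algorithm\<close>

text \<open>The projected gradient point, i.e. the Euclidean projection of \<open>x - \<tau> \<nabla>f(x)\<close> onto the box.\<close>

definition proj_grad ::
    "(real^'n \<Rightarrow> real^'n) \<Rightarrow> real^'n \<Rightarrow> real^'n \<Rightarrow> real \<Rightarrow> real^'n \<Rightarrow> real^'n" where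
  "proj_grad g l u \<tau> x = closest_point (box_set l u) (x - \<tau> *\<^sub>R g x)"

definition newton_system ::
    "(real^'n \<Rightarrow> real^'n) \<Rightarrow> (real^'n \<Rightarrow> real^'n^'n) \<Rightarrow> real^'n \<Rightarrow> real^'n \<Rightarrow> real \<Rightarrow> real \<Rightarrow>
     real^'n \<Rightarrow> real^'n \<Rightarrow> bool" where
  "newton_system g H l u lam \<tau> x d \<longleftrightarrow>
     (let \<Theta> = Theta_set g l u lam \<tau> x; \<Gamma> = Gamma_set g l u \<tau> x; I = I_set g l u lam \<tau> x in
      (\<forall>i\<in>\<Theta>. (\<Sum>j\<in>\<Theta>. H x $ i $ j * d $ j) + (\<Sum>j\<in>\<Gamma>. H x $ i $ j * d $ j)
              + (\<Sum>j\<in>- I. H x $ i $ j * d $ j) = - g x $ i) \<and>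
      (\<forall>i\<in>\<Gamma>. d $ i = proj_grad g l u \<tau> x $ i - x $ i) \<and>
      (\<forall>i\<in>- I. d $ i = - x $ i))"

text \<open>\<open>J\<close> is the index set of the previous iteration.\<close>

definition newton_accepted ::
    "(real^'n \<Rightarrow> real^'n) \<Rightarrow> real^'n \<Rightarrow> real^'n \<Rightarrow> real \<Rightarrow> real \<Rightarrow> real \<Rightarrow> 'n set \<Rightarrow>
     real^'n \<Rightarrow> real^'n \<Rightarrow> bool" where
  "newton_accepted g l u lam \<tau> \<delta> J x d \<longleftrightarrow>
     (let \<Theta> = Theta_set g l u lam \<tau> x; I = I_set g l u lam \<tau> x in
      (\<Sum>i\<in>I. g x $ i * d $ i) \<le> - \<delta> * (norm d)\<^sup>2 + (\<Sum>i\<in>- I. (x $ i)\<^sup>2) / (4 * \<tau>) \<and>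
      card I \<le> l0norm x \<and>
      x + d \<in> box_set l u \<and>
      (\<Theta> - J \<noteq> {} \<or> I = J))"

definition trial_point ::
    "(real^'n \<Rightarrow> real^'n) \<Rightarrow> real^'n \<Rightarrow> real^'n \<Rightarrow> real \<Rightarrow> real \<Rightarrow>
     real^'n \<Rightarrow> real^'n \<Rightarrow> real \<Rightarrow> real^'n" where
  "trial_point g l u lam \<tau> x d \<alpha> =
     (\<chi> i. if i \<in> Theta_set g l u lam \<tau> x then x $ i + \<alpha> * d $ i
           else if i \<in> Gamma_set g l u \<tau> x then x $ i + d $ i
           else 0)"

definition armijo ::
    "(real^'n \<Rightarrow> real) \<Rightarrow> (real^'n \<Rightarrow> real^'n) \<Rightarrow> real^'n \<Rightarrow> real^'n \<Rightarrow> real \<Rightarrow> real \<Rightarrow> real \<Rightarrow>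
     real^'n \<Rightarrow> real^'n \<Rightarrow> real \<Rightarrow> bool" where
  "armijo f g l u lam \<tau> \<sigma> x d \<alpha> \<longleftrightarrow>
     f (trial_point g l u lam \<tau> x d \<alpha>) \<le> f x + \<sigma> * \<alpha> * (g x \<bullet> d)"

definition line_search_result ::
    "(real^'n \<Rightarrow> real) \<Rightarrow> (real^'n \<Rightarrow> real^'n) \<Rightarrow> real^'n \<Rightarrow> real^'n \<Rightarrow> real \<Rightarrow> real \<Rightarrow> real \<Rightarrow> real \<Rightarrow>
     real^'n \<Rightarrow> real^'n \<Rightarrow> real^'n \<Rightarrow> bool" where
  "line_search_result f g l u lam \<tau> \<sigma> \<beta> x d x' \<longleftrightarrow>
     (\<exists>m::nat. armijo f g l u lam \<tau> \<sigma> x d (\<beta> ^ m) \<and>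
        (\<forall>j<m. \<not> armijo f g l u lam \<tau> \<sigma> x d (\<beta> ^ j)) \<and>
        x' = trial_point g l u lam \<tau> x d (\<beta> ^ m))"

definition pgm_direction ::
    "(real^'n \<Rightarrow> real^'n) \<Rightarrow> real^'n \<Rightarrow> real^'n \<Rightarrow> real \<Rightarrow> real \<Rightarrow> real^'n \<Rightarrow> real^'n" where
  "pgm_direction g l u lam \<tau> x =
     (\<chi> i. if i \<in> I_set g l u lam \<tau> x then proj_grad g l u \<tau> x $ i - x $ i else - x $ i)"

text \<open>
  \<open>nm k\<close> records whether the Newton branch is taken in iteration \<open>k\<close>. The Newton system may have
  several solutions, and the algorithm does not say which of them is computed and tested. The
  relation admits every choice: a Newton step may use any solution that passes the tests, and the
  gradient step is excluded exactly when the system is solvable and all its solutions pass. If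
  the solution is unique this is the plain if-then-else of the algorithm.
\<close>

definition bnl0r_run ::
    "(real^'n \<Rightarrow> real) \<Rightarrow> (real^'n \<Rightarrow> real^'n) \<Rightarrow> (real^'n \<Rightarrow> real^'n^'n) \<Rightarrow> real^'n \<Rightarrow> real^'n \<Rightarrow>
     real \<Rightarrow> real \<Rightarrow> real \<Rightarrow> real \<Rightarrow> real \<Rightarrow> (nat \<Rightarrow> real^'n) \<Rightarrow> (nat \<Rightarrow> bool) \<Rightarrow> bool" where
  "bnl0r_run f g H l u lam \<tau> \<delta> \<sigma> \<beta> x nm \<longleftrightarrow>
     x 0 \<in> box_set l u \<and>
     (\<forall>k. let J = (if k = 0 then {} else I_set g l u lam \<tau> (x (k - 1))) in
       if nm k then
         (\<exists>d. newton_system g H l u lam \<tau> (x k) d \<and>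
              newton_accepted g l u lam \<tau> \<delta> J (x k) d \<and>
              line_search_result f g l u lam \<tau> \<sigma> \<beta> (x k) d (x (Suc k)))
       else
         \<not> ((\<exists>d. newton_system g H l u lam \<tau> (x k) d) \<and>
            (\<forall>d. newton_system g H l u lam \<tau> (x k) d \<longrightarrow>
                 newton_accepted g l u lam \<tau> \<delta> J (x k) d)) \<and>
         x (Suc k) = x k + pgm_direction g l u lam \<tau> (x k))"

definition accumulation_point :: "(nat \<Rightarrow> 'a::topological_space) \<Rightarrow> 'a \<Rightarrow> bool" where
  "accumulation_point x y \<longleftrightarrow> (\<exists>r. strict_mono r \<and> (x \<circ> r) \<longlonglongrightarrow> y)"


section \<open>Strict complementarity and Abadie's constraint qualification\<close>

text \<open>
  Both refer to minimizing \<open>f\<close> subject to \<open>-l\<^sub>i \<le> x\<^sub>i \<le> u\<^sub>i\<close> for \<open>i \<in> J\<close> and \<open>x\<^sub>i = 0\<close> for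
  \<open>i \<notin> J\<close>. Multipliers are stored as full vectors, with zero entries where the
  constraint is absent.
\<close>

definition restricted_feasible :: "real^'n \<Rightarrow> real^'n \<Rightarrow> 'n set \<Rightarrow> (real^'n) set" where
  "restricted_feasible l u J =
     {x. (\<forall>i\<in>J. - l $ i \<le> x $ i \<and> x $ i \<le> u $ i) \<and> (\<forall>i\<in>- J. x $ i = 0)}"

definition kkt_multipliers ::
    "(real^'n \<Rightarrow> real^'n) \<Rightarrow> real^'n \<Rightarrow> real^'n \<Rightarrow> 'n set \<Rightarrow> real^'n \<Rightarrow>
     real^'n \<Rightarrow> real^'n \<Rightarrow> real^'n \<Rightarrow> bool" where
  "kkt_multipliers g l u J xs \<xi> b \<nu> \<longleftrightarrow>
     (\<forall>i\<in>J. \<xi> $ i \<ge> 0 \<and> b $ i \<ge> 0 \<and> \<nu> $ i = 0) \<and>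
     (\<forall>i\<in>- J. \<xi> $ i = 0 \<and> b $ i = 0) \<and>
     g xs + \<xi> - b + \<nu> = 0 \<and>
     (\<forall>i\<in>J. \<xi> $ i * (xs $ i - u $ i) = 0 \<and> b $ i * (- l $ i - xs $ i) = 0)"

text \<open>
  When \<open>l\<close> and \<open>u\<close> are positive the multipliers are unique if they exist, so quantifying
  universally over them is implied by the existential form; existence itself is not assumed here.
\<close>

definition strict_complementarity ::
    "(real^'n \<Rightarrow> real^'n) \<Rightarrow> real^'n \<Rightarrow> real^'n \<Rightarrow> 'n set \<Rightarrow> real^'n \<Rightarrow> bool" where
  "strict_complementarity g l u J xs \<longleftrightarrow>
     (\<forall>\<xi> b \<nu>. kkt_multipliers g l u J xs \<xi> b \<nu> \<longrightarrow>
        (\<forall>i\<in>J. (xs $ i = u $ i \<longrightarrow> \<xi> $ i > 0) \<and> (xs $ i = - l $ i \<longrightarrow> b $ i > 0)))"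

definition tangent_cone :: "'a::real_normed_vector set \<Rightarrow> 'a \<Rightarrow> 'a set" where
  "tangent_cone S x =
     {d. \<exists>y t. (\<forall>k::nat. y k \<in> S \<and> t k > 0) \<and> y \<longlonglongrightarrow> x \<and> t \<longlonglongrightarrow> (0::real) \<and>
         (\<lambda>k. (y k - x) /\<^sub>R t k) \<longlonglongrightarrow> d}"

definition linearized_cone :: "real^'n \<Rightarrow> real^'n \<Rightarrow> 'n set \<Rightarrow> real^'n \<Rightarrow> (real^'n) set" where
  "linearized_cone l u J xs =
     {d. (\<forall>i\<in>J. (xs $ i = u $ i \<longrightarrow> d $ i \<le> 0) \<and> (xs $ i = - l $ i \<longrightarrow> - d $ i \<le> 0)) \<and>
         (\<forall>i\<in>- J. d $ i = 0)}"

definition abadie_cq :: "real^'n \<Rightarrow> real^'n \<Rightarrow> 'n set \<Rightarrow> real^'n \<Rightarrow> bool" where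
  "abadie_cq l u J xs \<longleftrightarrow>
     tangent_cone (restricted_feasible l u J) xs = linearized_cone l u J xs"

end

theory Submission
  imports Defs
begin

text \<open>
  Once the index set is constant equal to \<open>I\<close>, the iterates vanish outside \<open>I\<close>, and both kinds of
  step decrease \<open>f\<close> by at least a fixed multiple of \<open>\<parallel>d\<^sup>k\<parallel>\<^sup>2\<close>: the line search accepts every step
  size below a positive constant. As \<open>f\<close> is bounded below, \<open>d\<^sup>k \<longlonglongrightarrow> 0\<close>, so the accumulation point is
  stationary for the problem restricted to \<open>I\<close>. Local strong convexity then gives quadratic growth
  of \<open>f\<close> on the restricted feasible set, which forces convergence of the whole sequence. By strict
  complementarity the active bounds are identified after finitely many steps, and the active
  coordinates are then exactly those of the limit. From then on the algorithm is Newton's method in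
  the free coordinates, with a Hessian bounded below by \<open>\<ell>\<^sub>*\<close>; as \<open>\<sigma> < 1 / 2\<close>, the unit step is
  accepted.
\<close>

section \<open>Projections onto the box\<close>

lemma box_set_eq_cbox: "box_set l u = cbox (- l) u"
  by (auto simp: box_set_def mem_box_cart)

text \<open>The box is a product of intervals, so clamping minimizes the distance in every
  coordinate at once and hence in norm; the closest point of a closed convex set is unique.\<close>

lemma proj_grad_nth:
  assumes "\<And>i. l $ i \<ge> 0" "\<And>i. u $ i \<ge> 0"
  shows "proj_grad g l u \<tau> x $ i = max (- l $ i) (min (u $ i) (x $ i - \<tau> * g x $ i))"
proof -
  define y where "y = x - \<tau> *\<^sub>R g x"
  define p where "p = (\<chi> i. max (- l $ i) (min (u $ i) (y $ i)))"
  have lu: "- l $ j \<le> u $ j" for j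
    using assms[of j] by linarith
  have "p \<in> box_set l u"
    using lu by (auto simp: box_set_def p_def max_def)
  moreover have "dist y p \<le> dist y z" if "z \<in> box_set l u" for z
    unfolding dist_norm
  proof (rule norm_le_componentwise_cart)
    fix j
    have "- l $ j \<le> z $ j" "z $ j \<le> u $ j"
      using that by (auto simp: box_set_def)
    then show "norm ((y - p) $ j) \<le> norm ((y - z) $ j)"
      using lu[of j] by (auto simp: p_def max_def min_def)
  qed
  ultimately have "p = closest_point (box_set l u) y"
    by (intro closest_point_unique) (auto simp: box_set_eq_cbox)
  then have "proj_grad g l u \<tau> x = p"
    by (simp add: proj_grad_def y_def)
  then show ?thesis
    by (simp add: p_def y_def)
qed

text \<open>The obtuse-angle inequality for the projection onto \<open>[lo, hi]\<close>, tested with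
  the feasible point \<open>t\<close>: expanding
  \<open>0 \<le> (p - t) * (t - \<tau> * \<gamma> - p)\<close> and dividing by \<tau> gives the
  bound.\<close>

lemma clamp_step_descent:
  fixes t \<tau> \<gamma> lo hi :: real
  assumes "lo \<le> t" "t \<le> hi" "\<tau> > 0"
  defines "p \<equiv> max lo (min hi (t - \<tau> * \<gamma>))"
  shows "\<gamma> * (p - t) \<le> - (p - t)\<^sup>2 / \<tau>"
proof -
  have "0 \<le> (p - t) * (t - \<tau> * \<gamma> - p)"
  proof (cases "p \<ge> t")
    case True
    then have "t = p \<or> p \<le> t - \<tau> * \<gamma>"
      using assms by (auto simp: p_def max_def min_def split: if_splits)
    then show ?thesis
      using True by auto
  next
    case False
    then have "p \<ge> t - \<tau> * \<gamma>"
      using assms by (auto simp: p_def max_def min_def split: if_splits)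
    then show ?thesis
      using False by (simp add: mult_nonpos_nonpos)
  qed
  then have "\<tau> * (\<gamma> * (p - t)) \<le> - (p - t)\<^sup>2"
    by (simp add: algebra_simps power2_eq_square)
  then show ?thesis
    using \<open>\<tau> > 0\<close> by (simp add: field_simps)
qed

text \<open>Fixed points of a projected gradient step are the KKT points of the interval: either the
  clamp does nothing, which forces a zero derivative, or it acts at an end point, which fixes the
  sign.\<close>

lemma clamp_fixpoint_sign:
  fixes t \<tau> \<gamma> lo hi :: real
  assumes "lo < hi" "\<tau> > 0" "max lo (min hi (t - \<tau> * \<gamma>)) = t"
  shows "lo < t \<and> t < hi \<and> \<gamma> = 0 \<or> t = hi \<and> \<gamma> \<le> 0 \<or> t = lo \<and> \<gamma> \<ge> 0"
proof -
  have "t = t - \<tau> * \<gamma> \<or> t = hi \<and> hi \<le> t - \<tau> * \<gamma> \<or> t = lo \<and> t - \<tau> * \<gamma> \<le> lo"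
    using assms(1,3) by (auto simp: max_def min_def split: if_splits)
  moreover have "lo \<le> t" "t \<le> hi"
    using assms(1,3) by (auto simp: max_def min_def split: if_splits)
  ultimately show ?thesis
    using \<open>\<tau> > 0\<close> by (auto simp: mult_le_0_iff zero_le_mult_iff)
qed

section \<open>Second-order estimates\<close>

text \<open>Adding the strong convexity inequality for the pairs (y, z) and (z, y) cancels the
  values of \<open>f\<close> and leaves strong monotonicity of the gradient. With
  \<open>z = y + t *\<^sub>R v\<close>, the difference quotient along \<open>v\<close> tends to the
  Hessian form as t decreases to 0.\<close>

lemma locally_strongly_convex_hessian:
  assumes "twice_cont_diff f g H" "locally_strongly_convex f g xs ell"
  shows "\<forall>\<^sub>F y in nhds xs. \<forall>v. ell * (norm v)\<^sup>2 \<le> v \<bullet> (H y *v v)"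
proof -
  obtain U where U: "open U" "xs \<in> U"
    and conv: "\<And>y z. y \<in> U \<Longrightarrow> z \<in> U \<Longrightarrow> f z \<ge> f y + g y \<bullet> (z - y) + ell / 2 * (norm (z - y))\<^sup>2"
    using assms(2) by (auto simp: locally_strongly_convex_def)
  have "ell * (norm v)\<^sup>2 \<le> v \<bullet> (H y *v v)" if "y \<in> U" for y v
  proof -
    have der: "((\<lambda>t. v \<bullet> g (y + t *\<^sub>R v)) has_real_derivative v \<bullet> (H y *v v)) (at 0)"
    proof -
      have "(g has_derivative (\<lambda>h. H y *v h)) (at (y + 0 *\<^sub>R v))"
        using assms(1) by (simp add: twice_cont_diff_def)
      then have "((\<lambda>t. v \<bullet> g (y + t *\<^sub>R v)) has_derivative (\<lambda>t. v \<bullet> (H y *v (t *\<^sub>R v)))) (at 0)"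
        by (auto intro!: derivative_eq_intros has_derivative_compose[where g = g and f = "\<lambda>t. y + t *\<^sub>R v"])
      then show ?thesis
        by (simp add: has_field_derivative_def matrix_vector_mult_scaleR mult_commute_abs)
    qed
    then have lim: "((\<lambda>t. (v \<bullet> g (y + t *\<^sub>R v) - v \<bullet> g y) / t) \<longlongrightarrow> v \<bullet> (H y *v v)) (at_right 0)"
      by (auto simp: has_field_derivative_iff intro: filterlim_mono[OF _ order_refl at_le])
    have "((\<lambda>t. y + t *\<^sub>R v) \<longlongrightarrow> y + 0 *\<^sub>R v) (at_right 0)"
      by (intro tendsto_intros)
    then have inU: "\<forall>\<^sub>F t in at_right 0. y + t *\<^sub>R v \<in> U"
      using U(1) that by (intro topological_tendstoD) auto
    have "\<forall>\<^sub>F t in at_right 0. ell * (norm v)\<^sup>2 \<le> (v \<bullet> g (y + t *\<^sub>R v) - v \<bullet> g y) / t"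
      using inU eventually_at_right_less[of 0]
    proof eventually_elim
      case (elim t)
      define z where "z = y + t *\<^sub>R v"
      have "f z \<ge> f y + t * (v \<bullet> g y) + ell / 2 * (t\<^sup>2 * (norm v)\<^sup>2)"
        using conv[of y z] that elim by (simp add: z_def power_mult_distrib inner_commute)
      moreover have "f y \<ge> f z - t * (v \<bullet> g z) + ell / 2 * (t\<^sup>2 * (norm v)\<^sup>2)"
        using conv[of z y] that elim by (simp add: z_def power_mult_distrib inner_commute)
      ultimately have "t * (t * (ell * (norm v)\<^sup>2)) \<le> t * (v \<bullet> g z - v \<bullet> g y)"
        by (simp add: algebra_simps power2_eq_square)
      then have "t * (ell * (norm v)\<^sup>2) \<le> v \<bullet> g z - v \<bullet> g y"
        using elim by (simp only: mult_le_cancel_left_pos)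
      then show ?case
        using elim by (simp add: pos_le_divide_eq z_def mult.commute)
    qed
    then show ?thesis
      by (intro tendsto_lowerbound[OF lim]) auto
  qed
  then show ?thesis
    using U by (auto simp: eventually_nhds)
qed

text \<open>Pairing with a fixed \<open>w\<close> makes the remainder scalar, so monotonicity of one
  real function replaces an integral. The Hessian varies by at most \<open>M * t * norm v\<close> at
  parameter t, and integrating t yields the factor 1/2.\<close>

lemma lipschitz_hessian_gradient_bound:
  assumes "twice_cont_diff f g H" "convex U"
    and lip: "\<And>y z. y \<in> U \<Longrightarrow> z \<in> U \<Longrightarrow> onorm (\<lambda>v. (H y - H z) *v v) \<le> M * norm (y - z)"
    and "y \<in> U" "z \<in> U" "M \<ge> 0"
  shows "w \<bullet> (g z - g y - H y *v (z - y)) \<le> M / 2 * (norm (z - y))\<^sup>2 * norm w"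
proof -
  define v where "v = z - y"
  \<comment> \<open>Up to the constant \<open>w \<bullet> g y\<close>, this is the remainder at time
    t minus the bound claimed for it, so it suffices that it does not increase.\<close>
  define \<phi> where "\<phi> t = w \<bullet> (g (y + t *\<^sub>R v) - t *\<^sub>R (H y *v v)) - M / 2 * t\<^sup>2 * (norm v)\<^sup>2 * norm w" for t
  have "\<phi> 1 \<le> \<phi> 0"
  proof (rule DERIV_nonpos_imp_nonincreasing[where f = \<phi>])
    fix t :: real
    assume t: "0 \<le> t" "t \<le> 1"
    define q where "q = y + t *\<^sub>R v"
    have "q \<in> U"
      using convexD[OF \<open>convex U\<close> \<open>y \<in> U\<close> \<open>z \<in> U\<close>, of "1 - t" t] t
      by (simp add: q_def v_def algebra_simps)
    have "(g has_derivative (\<lambda>h. H q *v h)) (at (y + t *\<^sub>R v))"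
      using assms(1) by (simp add: twice_cont_diff_def q_def)
    then have "(\<phi> has_derivative (\<lambda>s. w \<bullet> (H q *v (s *\<^sub>R v) - s *\<^sub>R (H y *v v)) - M / 2 * (2 * t * s) * (norm v)\<^sup>2 * norm w)) (at t)"
      unfolding \<phi>_def
      by (auto intro!: derivative_eq_intros has_derivative_compose[where g = g and f = "\<lambda>t. y + t *\<^sub>R v"])
    then have "(\<phi> has_real_derivative w \<bullet> ((H q - H y) *v v) - M * t * (norm v)\<^sup>2 * norm w) (at t)"
      unfolding has_field_derivative_def
      by (rule has_derivative_eq_rhs)
        (auto simp: fun_eq_iff matrix_vector_mult_scaleR matrix_vector_mult_diff_rdistrib algebra_simps inner_diff_right)
    moreover have "w \<bullet> ((H q - H y) *v v) \<le> M * t * (norm v)\<^sup>2 * norm w"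
    proof -
      have "w \<bullet> ((H q - H y) *v v) \<le> norm w * norm ((H q - H y) *v v)"
        by (rule norm_cauchy_schwarz)
      also have "norm ((H q - H y) *v v) \<le> onorm (\<lambda>v. (H q - H y) *v v) * norm v"
        by (rule onorm) simp
      also have "\<dots> \<le> M * norm (q - y) * norm v"
        using lip[OF \<open>q \<in> U\<close> \<open>y \<in> U\<close>] by (rule mult_right_mono) simp
      finally have "w \<bullet> ((H q - H y) *v v) \<le> norm w * (M * norm (q - y) * norm v)"
        by (simp add: mult_left_mono)
      then show ?thesis
        using t by (simp add: q_def power2_eq_square mult_ac)
    qed
    ultimately show "\<exists>D. (\<phi> has_real_derivative D) (at t) \<and> D \<le> 0"
      by force
  qed simp
  then show ?thesis
    by (simp add: \<phi>_def v_def inner_diff_right)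
qed

text \<open>The quantity bounded by \<open>B\<close> is the derivative in t of the second-order
  remainder along the segment, so subtracting \<open>t * B\<close> from that remainder gives a
  nonincreasing function.\<close>

lemma taylor_upper_bound:
  assumes "twice_cont_diff f g H" 
    and bound: "\<And>t. 0 \<le> t \<Longrightarrow> t \<le> 1 \<Longrightarrow>
      d \<bullet> (g (y + t *\<^sub>R d) - g y - H y *v (t *\<^sub>R d)) \<le> B"
  shows "f (y + d) \<le> f y + g y \<bullet> d + (d \<bullet> (H y *v d)) / 2 + B"
proof -
  define \<psi> where "\<psi> t = f (y + t *\<^sub>R d) - t * (g y \<bullet> d) - t\<^sup>2 / 2 * (d \<bullet> (H y *v d)) - t * B" for t
  have "\<psi> 1 \<le> \<psi> 0"
  proof (rule DERIV_nonpos_imp_nonincreasing[where f = \<psi>])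
    fix t :: real
    assume t: "0 \<le> t" "t \<le> 1"
    have "(f has_derivative (\<lambda>h. h \<bullet> g (y + t *\<^sub>R d))) (at (y + t *\<^sub>R d))"
      using assms(1) by (simp add: twice_cont_diff_def gderiv_def)
    then have "(\<psi> has_derivative (\<lambda>s. (s *\<^sub>R d) \<bullet> g (y + t *\<^sub>R d) - s * (g y \<bullet> d) - (2 * t * s) / 2 * (d \<bullet> (H y *v d)) - s * B)) (at t)"
      unfolding \<psi>_def
      by (auto intro!: derivative_eq_intros has_derivative_compose[where g = f and f = "\<lambda>t. y + t *\<^sub>R d"])
    then have "(\<psi> has_real_derivative d \<bullet> (g (y + t *\<^sub>R d) - g y - H y *v (t *\<^sub>R d)) - B) (at t)"
      unfolding has_field_derivative_def
      by (rule has_derivative_eq_rhs)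
        (auto simp: fun_eq_iff matrix_vector_mult_scaleR algebra_simps inner_diff_right inner_commute)
    then show "\<exists>D. (\<psi> has_real_derivative D) (at t) \<and> D \<le> 0"
      using bound[OF t] by force
  qed simp
  then show ?thesis
    by (simp add: \<psi>_def)
qed

section \<open>Sufficient decrease\<close>

lemma norm_sq_sum: "(norm (d :: real^'n::finite))\<^sup>2 = (\<Sum>i\<in>UNIV. (d $ i)\<^sup>2)"
  unfolding power2_norm_eq_inner inner_vec_def by (simp add: power2_eq_square)

locale bnl0r =
  fixes f :: "real^'n \<Rightarrow> real"
    and g :: "real^'n \<Rightarrow> real^'n"
    and H :: "real^'n \<Rightarrow> real^'n^'n"
    and l u :: "real^'n"
    and lam \<tau> \<delta> \<sigma> \<beta> L :: real
    and x :: "nat \<Rightarrow> real^'n"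
    and nm :: "nat \<Rightarrow> bool"
  assumes C2: "twice_cont_diff f g H"
    and l_pos: "\<And>i. l $ i > 0" and u_pos: "\<And>i. u $ i > 0"
    and \<sigma>: "0 < \<sigma>" "\<sigma> < 1 / 2"
    and \<beta>: "0 < \<beta>" "\<beta> < 1"
    and L_pos: "L > 0"
    and \<delta>_pos: "0 < \<delta>"
    and lam_pos: "0 < lam"
    and \<tau>_pos: "0 < \<tau>"
    and \<tau>_less: "\<tau> < 1 / (4 * L)"
    and run: "bnl0r_run f g H l u lam \<tau> \<delta> \<sigma> \<beta> x nm"
    and smooth: "strongly_smooth f g L"
begin

section \<open>Index sets, projections and the two branches of the run\<close>

abbreviation "\<Theta> y \<equiv> Theta_set g l u lam \<tau> y"
abbreviation "\<Gamma> y \<equiv> Gamma_set g l u \<tau> y"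
abbreviation "\<I> y \<equiv> I_set g l u lam \<tau> y"
abbreviation "P y \<equiv> proj_grad g l u \<tau> y"

lemma P_nth: "P y $ i = max (- l $ i) (min (u $ i) (y $ i - \<tau> * g y $ i))"
  using l_pos u_pos by (intro proj_grad_nth) (auto intro: less_imp_le)

lemma P_in_box: "- l $ i \<le> P y $ i" "P y $ i \<le> u $ i"
  using l_pos[of i] u_pos[of i] by (auto simp: P_nth)

lemma P_step:
  assumes "y \<in> box_set l u"
  shows "g y $ i * (P y $ i - y $ i) \<le> - (P y $ i - y $ i)\<^sup>2 / \<tau>"
  unfolding P_nth using assms \<tau>_pos by (intro clamp_step_descent) (auto simp: box_set_def)

lemma P_Theta: "i \<in> \<Theta> y \<Longrightarrow> P y $ i = y $ i - \<tau> * g y $ i"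
  by (auto simp: P_nth Theta_set_def)

lemma Theta_Gamma_disjoint: "i \<in> \<Theta> y \<Longrightarrow> i \<notin> \<Gamma> y"
  by (auto simp: Theta_set_def Gamma_set_def)

lemma g_cont: "isCont g y"
  using C2 by (auto simp: twice_cont_diff_def intro: has_derivative_continuous)

lemma f_cont: "isCont f y"
  using C2 by (auto simp: twice_cont_diff_def gderiv_def intro: has_derivative_continuous)

lemma H_cont: "isCont H y"
  using C2 by (simp add: twice_cont_diff_def continuous_on_eq_continuous_at)

text \<open>\<open>\<Theta>\<close>, \<open>\<Gamma>\<close> and the complement of
  \<open>\<I>\<close> partition the indices, so the three block sums make up one row of the full
  Hessian product.\<close>

lemma newton_system_alt:
  "newton_system g H l u lam \<tau> y d \<longleftrightarrow>
     (\<forall>i\<in>\<Theta> y. (H y *v d) $ i = - g y $ i) \<and>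
     (\<forall>i\<in>\<Gamma> y. d $ i = P y $ i - y $ i) \<and> (\<forall>i\<in>- \<I> y. d $ i = - y $ i)"
proof -
  have "(\<Sum>j\<in>\<Theta> y. H y $ i $ j * d $ j) + (\<Sum>j\<in>\<Gamma> y. H y $ i $ j * d $ j)
      + (\<Sum>j\<in>- \<I> y. H y $ i $ j * d $ j) = (H y *v d) $ i" for i
  proof -
    have "(H y *v d) $ i = (\<Sum>j\<in>(\<Theta> y \<union> \<Gamma> y) \<union> - \<I> y. H y $ i $ j * d $ j)"
      by (auto simp: matrix_vector_mult_def I_set_def intro!: sum.cong)
    also have "\<dots> = (\<Sum>j\<in>\<Theta> y \<union> \<Gamma> y. H y $ i $ j * d $ j) + (\<Sum>j\<in>- \<I> y. H y $ i $ j * d $ j)"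
      by (rule sum.union_disjoint) (auto simp: I_set_def)
    also have "(\<Sum>j\<in>\<Theta> y \<union> \<Gamma> y. H y $ i $ j * d $ j) =
        (\<Sum>j\<in>\<Theta> y. H y $ i $ j * d $ j) + (\<Sum>j\<in>\<Gamma> y. H y $ i $ j * d $ j)"
      using Theta_Gamma_disjoint by (intro sum.union_disjoint) auto
    finally show ?thesis by simp
  qed
  then show ?thesis
    by (simp add: newton_system_def Let_def)
qed

abbreviation prev :: "nat \<Rightarrow> 'n set" where
  "prev k \<equiv> if k = 0 then {} else \<I> (x (k - 1))"

lemma newton_stepE:
  assumes "nm k"
  obtains d m where "newton_system g H l u lam \<tau> (x k) d"
    and "newton_accepted g l u lam \<tau> \<delta> (prev k) (x k) d"
    and "armijo f g l u lam \<tau> \<sigma> (x k) d (\<beta> ^ m)"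
    and "\<And>j. j < m \<Longrightarrow> \<not> armijo f g l u lam \<tau> \<sigma> (x k) d (\<beta> ^ j)"
    and "x (Suc k) = trial_point g l u lam \<tau> (x k) d (\<beta> ^ m)"
  using run assms unfolding bnl0r_run_def line_search_result_def Let_def by metis

lemma gradient_step:
  assumes "\<not> nm k"
  shows "x (Suc k) = x k + pgm_direction g l u lam \<tau> (x k)"
  using run assms unfolding bnl0r_run_def Let_def by metis

text \<open>A gradient step needs an unsolvable system or some solution that fails the tests. Both
  must be excluded, hence the quantification over all solutions.\<close>

lemma newton_forced:
  assumes "newton_system g H l u lam \<tau> (x k) d"
    and "\<And>d. newton_system g H l u lam \<tau> (x k) d \<Longrightarrow> newton_accepted g l u lam \<tau> \<delta> (prev k) (x k) d"
  shows "nm k"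
  using run assms unfolding bnl0r_run_def Let_def by metis

lemma x_outside:
  assumes "i \<notin> \<I> (x k)"
  shows "x (Suc k) $ i = 0"
proof (cases "nm k")
  case True
  then show ?thesis
    using assms by (elim newton_stepE) (simp add: trial_point_def I_set_def)
next
  case False
  then show ?thesis
    using assms by (simp add: gradient_step pgm_direction_def)
qed

text \<open>Neither branch damps these coordinates, whatever the step size. This lets active
  coordinates land exactly on their bounds in a single iteration.\<close>

lemma x_Gamma:
  assumes "i \<in> \<Gamma> (x k)"
  shows "x (Suc k) $ i = P (x k) $ i"
proof (cases "nm k")
  case True
  then show ?thesis
    using assms Theta_Gamma_disjoint[of i "x k"]
    by (elim newton_stepE) (auto simp: trial_point_def newton_system_alt)
next
  case False
  then show ?thesis
    using assms by (simp add: gradient_step pgm_direction_def I_set_def)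
qed

lemma beta_power: "0 < \<beta> ^ m" "\<beta> ^ m \<le> 1"
  using \<beta> by (auto intro: power_le_one)

text \<open>A damped Newton coordinate is a convex combination of \<open>x k $ i\<close> and
  \<open>(x k + d) $ i\<close>; the latter is feasible by the acceptance test. All other coordinates
  are projected values or 0.\<close>

lemma x_in_box: "x k \<in> box_set l u"
proof (induction k)
  case 0
  then show ?case using run by (simp add: bnl0r_run_def)
next
  case (Suc k)
  have "- l $ i \<le> x (Suc k) $ i \<and> x (Suc k) $ i \<le> u $ i" for i
  proof (cases "i \<in> \<I> (x k)")
    case False
    then show ?thesis
      using l_pos[of i] u_pos[of i] by (simp add: x_outside)
  next
    case True
    show ?thesis
    proof (cases "nm k \<and> i \<in> \<Theta> (x k)")
      case nT: True
      then obtain d m where d: "newton_accepted g l u lam \<tau> \<delta> (prev k) (x k) d"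
        and x': "x (Suc k) = trial_point g l u lam \<tau> (x k) d (\<beta> ^ m)"
        by (elim conjE newton_stepE) blast
      have "x (Suc k) $ i = (1 - \<beta> ^ m) * x k $ i + \<beta> ^ m * (x k + d) $ i"
        using nT by (simp add: x' trial_point_def algebra_simps)
      moreover have "x k $ i \<in> {- l $ i..u $ i}" "(x k + d) $ i \<in> {- l $ i..u $ i}"
        using Suc d by (auto simp: newton_accepted_def Let_def box_set_def)
      ultimately show ?thesis
        using convexD[OF convex_real_interval(5), of "x k $ i" "- l $ i" "u $ i" "(x k + d) $ i" "1 - \<beta> ^ m" "\<beta> ^ m"]
          beta_power[of m] by auto
    next
      case not: False
      have "x (Suc k) $ i = P (x k) $ i"
      proof (cases "nm k")
        case True
        then show ?thesis
          using not \<open>i \<in> \<I> (x k)\<close> by (intro x_Gamma) (auto simp: I_set_def)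
      next
        case False
        then show ?thesis
          using \<open>i \<in> \<I> (x k)\<close> by (simp add: gradient_step pgm_direction_def)
      qed
      then show ?thesis
        by (simp add: P_in_box)
    qed
  qed
  then show ?case
    by (simp add: box_set_def)
qed

section \<open>Decrease of the objective in a single iteration\<close>

lemma inv_tau: "4 * L \<le> 1 / \<tau>"
  using \<tau>_less \<tau>_pos L_pos by (simp add: field_simps)

text \<open>
  The components in \<open>\<Gamma>\<close> move by the full \<open>d\<close> whatever the step size is; the factor \<open>7 / 8\<close> keeps
  their contribution to the Armijo inequality nonpositive, using \<open>\<tau> < 1 / (4 L)\<close>.
\<close>

definition "\<alpha>0 = min (7 / 8) (2 * (1 - \<sigma>) * \<delta> / L)"

lemma alpha0: "0 < \<alpha>0" "\<alpha>0 \<le> 7 / 8" "\<alpha>0 \<le> 2 * (1 - \<sigma>) * \<delta> / L"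
  using \<sigma> \<delta>_pos L_pos by (auto simp: \<alpha>0_def)

text \<open>The first entry serves Newton steps, whose step size is at least
  \<open>\<beta> * \<alpha>0\<close>; the second serves gradient steps, which in fact gain 7/2 times
  \<open>L\<close>.\<close>

definition "rate = min (\<sigma> * (\<beta> * \<alpha>0) * \<delta>) L"

lemma rate_pos: "rate > 0"
  using \<sigma> \<beta> alpha0 \<delta>_pos L_pos by (simp add: rate_def)

context
  fixes k
  assumes supp: "\<And>i. i \<notin> \<I> (x k) \<Longrightarrow> x k $ i = 0"
begin

text \<open>When the iterate vanishes outside \<open>\<I> (x k)\<close>, so does \<open>d\<close>,
  and the relaxation term with \<open>4 * \<tau>\<close> in the acceptance test is 0. The test then
  concerns the full inner product.\<close>

lemma newton_decrease:
  assumes "newton_system g H l u lam \<tau> (x k) d"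
    and "newton_accepted g l u lam \<tau> \<delta> (prev k) (x k) d"
  shows "g (x k) \<bullet> d \<le> - \<delta> * (norm d)\<^sup>2"
proof -
  have "d $ i = 0" if "i \<notin> \<I> (x k)" for i
    using assms(1) that supp by (auto simp: newton_system_alt)
  then have "g (x k) \<bullet> d = (\<Sum>i\<in>\<I> (x k). g (x k) $ i * d $ i)"
    unfolding inner_vec_def inner_real_def by (intro sum.mono_neutral_right) auto
  moreover have "(\<Sum>i\<in>- \<I> (x k). (x k $ i)\<^sup>2) = 0"
    using supp by (intro sum.neutral) auto
  ultimately show ?thesis
    using assms(2) by (simp add: newton_accepted_def Let_def)
qed

text \<open>The quadratic upper model of \<open>f\<close> at the trial point is compared
  coordinatewise with its value for the uniform step \<alpha> d. After that the usual Armijo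
  argument from smoothness and sufficient descent applies.\<close>

lemma armijo_small_step:
  assumes sys: "newton_system g H l u lam \<tau> (x k) d"
    and acc: "newton_accepted g l u lam \<tau> \<delta> (prev k) (x k) d"
    and \<alpha>: "0 < \<alpha>" "\<alpha> \<le> \<alpha>0"
  shows "armijo f g l u lam \<tau> \<sigma> (x k) d \<alpha>"
proof -
  define y where "y = x k"
  define e where "e = trial_point g l u lam \<tau> y d \<alpha> - y"
  have summand: "g y $ i * e $ i + L / 2 * (e $ i)\<^sup>2 \<le> \<alpha> * (g y $ i * d $ i) + L / 2 * \<alpha>\<^sup>2 * (d $ i)\<^sup>2" for i
  proof -
    consider "i \<in> \<Theta> y" | "i \<in> \<Gamma> y" "i \<notin> \<Theta> y" | "i \<notin> \<I> y"
      by (auto simp: I_set_def)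
    then show ?thesis
    proof cases
      case 1
      then have "e $ i = \<alpha> * d $ i"
        by (simp add: e_def trial_point_def)
      then show ?thesis
        by (simp add: power_mult_distrib)
    next
      case 2
      then have e: "e $ i = d $ i"
        by (simp add: e_def trial_point_def)
      have "g y $ i * d $ i \<le> - (d $ i)\<^sup>2 / \<tau>"
        using P_step[OF x_in_box[of k], of i] sys 2 by (simp add: newton_system_alt y_def)
      also have "\<dots> = - ((d $ i)\<^sup>2 * (1 / \<tau>))"
        by simp
      also have "\<dots> \<le> - ((d $ i)\<^sup>2 * (4 * L))"
        using inv_tau by (intro le_imp_neg_le mult_left_mono) auto
      finally have "(1 - \<alpha>) * (g y $ i * d $ i) \<le> (1 - \<alpha>) * - ((d $ i)\<^sup>2 * (4 * L))"
        using \<alpha> alpha0 by (intro mult_left_mono) auto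
      \<comment> \<open>One eighth of the coefficient \<open>4 * L\<close> is \<open>L / 2\<close>,
        exactly the curvature term to be compensated.\<close>
      also have "\<dots> \<le> (1 / 8) * - ((d $ i)\<^sup>2 * (4 * L))"
        using \<alpha> alpha0 L_pos by (intro mult_right_mono_neg) auto
      finally have "(1 - \<alpha>) * (g y $ i * d $ i) + L / 2 * (d $ i)\<^sup>2 \<le> 0"
        by simp
      moreover have "0 \<le> L / 2 * \<alpha>\<^sup>2 * (d $ i)\<^sup>2"
        using L_pos by simp
      ultimately show ?thesis
        by (simp add: e left_diff_distrib)
    next
      case 3
      then have "y $ i = 0" "d $ i = 0"
        using sys supp by (auto simp: newton_system_alt y_def)
      then show ?thesis
        using 3 by (simp add: e_def trial_point_def I_set_def)
    qed
  qed
  have "f (y + e) \<le> f y + (g y \<bullet> e + L / 2 * (norm e)\<^sup>2)"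
    using smooth[unfolded strongly_smooth_def, rule_format, of "y + e" y] by (simp add: add.assoc)
  also have "g y \<bullet> e + L / 2 * (norm e)\<^sup>2 = (\<Sum>i\<in>UNIV. g y $ i * e $ i + L / 2 * (e $ i)\<^sup>2)"
    by (simp add: inner_vec_def norm_sq_sum sum.distrib sum_distrib_left)
  also have "\<dots> \<le> (\<Sum>i\<in>UNIV. \<alpha> * (g y $ i * d $ i) + L / 2 * \<alpha>\<^sup>2 * (d $ i)\<^sup>2)"
    by (intro sum_mono summand)
  also have "\<dots> = \<alpha> * (g y \<bullet> d) + L / 2 * \<alpha>\<^sup>2 * (norm d)\<^sup>2"
    by (simp add: inner_vec_def norm_sq_sum sum.distrib sum_distrib_left)
  finally have 1: "f (y + e) \<le> f y + (\<alpha> * (g y \<bullet> d) + L / 2 * \<alpha>\<^sup>2 * (norm d)\<^sup>2)"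
    by simp
  have "(1 - \<sigma>) * \<alpha> * (g y \<bullet> d) \<le> (1 - \<sigma>) * \<alpha> * (- \<delta> * (norm d)\<^sup>2)"
    using newton_decrease[OF sys acc] \<alpha> \<sigma> by (intro mult_left_mono) (auto simp: y_def)
  \<comment> \<open>The second entry of \<open>\<alpha>0\<close> is chosen for this: the curvature
    term is absorbed by the share 1 - \<sigma> of the linear decrease.\<close>
  moreover have "\<alpha> * L \<le> 2 * (1 - \<sigma>) * \<delta>"
    using \<alpha> alpha0(3) L_pos by (simp add: pos_le_divide_eq order_trans[OF mult_right_mono])
  then have "\<alpha> * (norm d)\<^sup>2 / 2 * (\<alpha> * L) \<le> \<alpha> * (norm d)\<^sup>2 / 2 * (2 * (1 - \<sigma>) * \<delta>)"
    using \<alpha> by (intro mult_left_mono) auto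
  ultimately have "\<alpha> * (g y \<bullet> d) + L / 2 * \<alpha>\<^sup>2 * (norm d)\<^sup>2 \<le> \<sigma> * \<alpha> * (g y \<bullet> d)"
    by (simp add: algebra_simps power2_eq_square)
  with 1 have "f (y + e) \<le> f y + \<sigma> * \<alpha> * (g y \<bullet> d)"
    by linarith
  then show ?thesis
    by (simp add: armijo_def e_def y_def)
qed

text \<open>A common form for both branches, with \<open>d\<close> the undamped direction. The last
  clause says that \<open>d\<close> controls the projected-gradient residual: on
  \<open>\<Theta>\<close> the residual is -\<tau> times the gradient, which in a Newton step is
  \<tau> times the entry of \<open>H (x k) *v d\<close>; elsewhere on \<open>\<I>\<close>, and in
  gradient steps, it is \<open>d\<close> itself.\<close>

lemma step_estimate:
  "\<exists>d. norm (x (Suc k) - x k) \<le> norm d \<and> f (x (Suc k)) + rate * (norm d)\<^sup>2 \<le> f (x k) \<and>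
     (\<forall>i\<in>\<I> (x k). \<bar>P (x k) $ i - x k $ i\<bar> \<le> \<bar>d $ i\<bar> + \<tau> * \<bar>(H (x k) *v d) $ i\<bar>)"
proof (cases "nm k")
  case True
  then obtain d m where sys: "newton_system g H l u lam \<tau> (x k) d"
    and acc: "newton_accepted g l u lam \<tau> \<delta> (prev k) (x k) d"
    and arm: "armijo f g l u lam \<tau> \<sigma> (x k) d (\<beta> ^ m)"
    and fails: "\<And>j. j < m \<Longrightarrow> \<not> armijo f g l u lam \<tau> \<sigma> (x k) d (\<beta> ^ j)"
    and x': "x (Suc k) = trial_point g l u lam \<tau> (x k) d (\<beta> ^ m)"
    by (elim newton_stepE) blast
  have "\<beta> * \<alpha>0 \<le> \<beta> ^ m"
  proof (cases m)
    case 0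
    then show ?thesis
      using mult_mono[of \<beta> 1 \<alpha>0 1] \<beta> alpha0 by simp
  next
    \<comment> \<open>Minimality of m: the previous trial size was rejected, so it exceeds
      \<open>\<alpha>0\<close>, and one factor \<beta> is lost.\<close>
    case (Suc j)
    then have "\<alpha>0 < \<beta> ^ j"
      using fails[of j] armijo_small_step[OF sys acc, of "\<beta> ^ j"] beta_power[of j] by force
    then show ?thesis
      using Suc \<beta> by simp
  qed
  have "f (x (Suc k)) \<le> f (x k) + \<sigma> * \<beta> ^ m * (g (x k) \<bullet> d)"
    using arm by (simp add: x' armijo_def)
  also have "\<sigma> * \<beta> ^ m * (g (x k) \<bullet> d) \<le> \<sigma> * \<beta> ^ m * (- \<delta> * (norm d)\<^sup>2)"
    using newton_decrease[OF sys acc] \<sigma> beta_power[of m] by (intro mult_left_mono) auto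
  also have "\<dots> \<le> \<sigma> * (\<beta> * \<alpha>0) * (- \<delta> * (norm d)\<^sup>2)"
    using \<open>\<beta> * \<alpha>0 \<le> \<beta> ^ m\<close> \<sigma> \<delta>_pos by (intro mult_right_mono_neg mult_left_mono) auto
  also have "\<dots> = - ((\<sigma> * (\<beta> * \<alpha>0) * \<delta>) * (norm d)\<^sup>2)"
    by simp
  also have "\<dots> \<le> - (rate * (norm d)\<^sup>2)"
    by (intro le_imp_neg_le mult_right_mono) (auto simp: rate_def)
  finally have "f (x (Suc k)) + rate * (norm d)\<^sup>2 \<le> f (x k)"
    by simp
  moreover have "norm (x (Suc k) - x k) \<le> norm d"
  proof (rule norm_le_componentwise_cart)
    fix i
    show "norm ((x (Suc k) - x k) $ i) \<le> norm (d $ i)"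
      using supp[of i] beta_power[of m] mult_left_le_one_le[of "\<bar>d $ i\<bar>" "\<beta> ^ m"]
      by (auto simp: x' trial_point_def I_set_def abs_mult)
  qed
  moreover have "\<bar>P (x k) $ i - x k $ i\<bar> \<le> \<bar>d $ i\<bar> + \<tau> * \<bar>(H (x k) *v d) $ i\<bar>" if "i \<in> \<I> (x k)" for i
  proof (cases "i \<in> \<Theta> (x k)")
    case True
    then show ?thesis
      using sys \<tau>_pos by (simp add: P_Theta newton_system_alt abs_mult)
  next
    case False
    then show ?thesis
      using sys \<tau>_pos that by (simp add: newton_system_alt I_set_def)
  qed
  ultimately show ?thesis
    by blast
next
  case False
  define d where "d = pgm_direction g l u lam \<tau> (x k)"
  have x': "x (Suc k) = x k + d"
    using False by (simp add: gradient_step d_def)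
  have d: "d $ i = (if i \<in> \<I> (x k) then P (x k) $ i - x k $ i else 0)" for i
    using supp by (simp add: d_def pgm_direction_def)
  have "g (x k) $ i * d $ i \<le> - (4 * L) * (d $ i)\<^sup>2" for i
  proof (cases "i \<in> \<I> (x k)")
    case True
    have "g (x k) $ i * d $ i \<le> - ((1 / \<tau>) * (d $ i)\<^sup>2)"
      using True P_step[OF x_in_box[of k], of i] by (simp add: d)
    also have "\<dots> \<le> - ((4 * L) * (d $ i)\<^sup>2)"
      using inv_tau by (intro le_imp_neg_le mult_right_mono) auto
    finally show ?thesis by simp
  qed (simp add: d)
  then have "g (x k) \<bullet> d \<le> - (4 * L) * (norm d)\<^sup>2"
    unfolding inner_vec_def norm_sq_sum sum_distrib_left by (auto intro!: sum_mono)
  moreover have "f (x (Suc k)) \<le> f (x k) + g (x k) \<bullet> d + L / 2 * (norm d)\<^sup>2"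
    using smooth[unfolded strongly_smooth_def, rule_format, of "x (Suc k)" "x k"] by (simp add: x')
  moreover have "rate * (norm d)\<^sup>2 \<le> L * (norm d)\<^sup>2"
    by (intro mult_right_mono) (auto simp: rate_def)
  moreover have "0 \<le> L * (norm d)\<^sup>2"
    using L_pos by simp
  ultimately have "f (x (Suc k)) + rate * (norm d)\<^sup>2 \<le> f (x k)"
    by linarith
  then show ?thesis
    using \<tau>_pos by (intro exI[of _ d]) (simp add: x' d)
qed

end

end

section \<open>Convergence of the whole sequence\<close>

locale bnl0r_limit = bnl0r f g H l u lam \<tau> \<delta> \<sigma> \<beta> L x nm
  for f :: "real^'n \<Rightarrow> real" and g H l u lam \<tau> \<delta> \<sigma> \<beta> L x nm +
  fixes ell :: real and I :: "'n set" and N :: nat and xs :: "real^'n"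
  assumes bdd: "bdd_below (range f)"
    and \<I>_eq: "\<And>k. k \<ge> N \<Longrightarrow> \<I> (x k) = I"
    and acc: "accumulation_point x xs"
    and strict: "strict_complementarity g l u I xs"
    and lsc: "locally_strongly_convex f g xs ell"
    and ell_pos: "ell > 0" and \<delta>_less: "\<delta> < ell"
begin

text \<open>Iterate k is cleared by the index set of iteration k - 1, whence the strict
  inequality.\<close>

lemma x_outside_I: "k > N \<Longrightarrow> i \<notin> I \<Longrightarrow> x k $ i = 0"
  using x_outside[of i "k - 1"] \<I>_eq[of "k - 1"] by simp

text \<open>A choice of the direction from \<open>step_estimate\<close> for each iteration; only the
  values beyond \<open>N\<close> carry information.\<close>

definition "D = (SOME D. \<forall>k>N. norm (x (Suc k) - x k) \<le> norm (D k) \<and>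
     f (x (Suc k)) + rate * (norm (D k))\<^sup>2 \<le> f (x k) \<and>
     (\<forall>i\<in>I. \<bar>P (x k) $ i - x k $ i\<bar> \<le> \<bar>D k $ i\<bar> + \<tau> * \<bar>(H (x k) *v D k) $ i\<bar>))"

lemma D:
  assumes "k > N"
  shows "norm (x (Suc k) - x k) \<le> norm (D k)"
    and "f (x (Suc k)) + rate * (norm (D k))\<^sup>2 \<le> f (x k)"
    and "i \<in> I \<Longrightarrow> \<bar>P (x k) $ i - x k $ i\<bar> \<le> \<bar>D k $ i\<bar> + \<tau> * \<bar>(H (x k) *v D k) $ i\<bar>"
proof -
  have "\<forall>k. \<exists>d. k > N \<longrightarrow> norm (x (Suc k) - x k) \<le> norm d \<and>
     f (x (Suc k)) + rate * (norm d)\<^sup>2 \<le> f (x k) \<and>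
     (\<forall>i\<in>I. \<bar>P (x k) $ i - x k $ i\<bar> \<le> \<bar>d $ i\<bar> + \<tau> * \<bar>(H (x k) *v d) $ i\<bar>)"
  proof (intro allI)
    fix k
    show "\<exists>d. k > N \<longrightarrow> norm (x (Suc k) - x k) \<le> norm d \<and>
     f (x (Suc k)) + rate * (norm d)\<^sup>2 \<le> f (x k) \<and>
     (\<forall>i\<in>I. \<bar>P (x k) $ i - x k $ i\<bar> \<le> \<bar>d $ i\<bar> + \<tau> * \<bar>(H (x k) *v d) $ i\<bar>)"
      using step_estimate[of k] x_outside_I[of k] \<I>_eq[of k] by (cases "k > N") auto
  qed
  from someI_ex[OF this[unfolded choice_iff]] assms
  show "norm (x (Suc k) - x k) \<le> norm (D k)"
    and "f (x (Suc k)) + rate * (norm (D k))\<^sup>2 \<le> f (x k)"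
    and "i \<in> I \<Longrightarrow> \<bar>P (x k) $ i - x k $ i\<bar> \<le> \<bar>D k $ i\<bar> + \<tau> * \<bar>(H (x k) *v D k) $ i\<bar>"
    unfolding D_def by blast+
qed

section \<open>Limits of the function values and of the directions\<close>

definition "r = (SOME r. strict_mono r \<and> (x \<circ> r) \<longlonglongrightarrow> xs)"

lemma r: "strict_mono r" "(\<lambda>n. x (r n)) \<longlonglongrightarrow> xs"
  using someI_ex[OF acc[unfolded accumulation_point_def]] by (simp_all add: r_def o_def)

lemma r_at_top: "filterlim r sequentially sequentially"
  using r(1) by (rule filterlim_subseq)

text \<open>The values are eventually decreasing and bounded below, hence convergent; continuity
  along the subsequence \<open>r\<close> identifies the limit.\<close>

lemma f_limit: "(\<lambda>k. f (x k)) \<longlonglongrightarrow> f xs"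
proof -
  obtain B where B: "\<And>y. B \<le> f y"
    using bdd by (auto simp: bdd_below_def)
  have "decseq (\<lambda>n. f (x (n + Suc N)))"
  proof (rule decseq_SucI)
    fix n
    have "0 \<le> rate * (norm (D (n + Suc N)))\<^sup>2"
      using rate_pos by simp
    then show "f (x (Suc n + Suc N)) \<le> f (x (n + Suc N))"
      using D(2)[of "n + Suc N"] by simp
  qed
  then obtain F where "(\<lambda>n. f (x (n + Suc N))) \<longlonglongrightarrow> F"
    using decseq_convergent B by blast
  then have F: "(\<lambda>k. f (x k)) \<longlonglongrightarrow> F"
    by (rule LIMSEQ_offset)
  moreover have "(\<lambda>n. f (x (r n))) \<longlonglongrightarrow> f xs"
    using f_cont r(2) by (rule isCont_tendsto_compose)
  moreover have "(\<lambda>n. f (x (r n))) \<longlonglongrightarrow> F"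
    using filterlim_compose[OF F r_at_top] .
  ultimately show ?thesis
    using LIMSEQ_unique by blast
qed

text \<open>Consecutive differences of the convergent values \<open>f (x k)\<close> tend to 0 and
  dominate \<open>rate * (norm (D k))\<^sup>2\<close>.\<close>

lemma D_tendsto_0: "D \<longlonglongrightarrow> 0"
proof -
  have "(\<lambda>k. (f (x k) - f (x (Suc k))) / rate) \<longlonglongrightarrow> (f xs - f xs) / rate"
    using rate_pos by (intro tendsto_intros f_limit filterlim_compose[OF f_limit filterlim_Suc]) auto
  then have lim: "(\<lambda>k. (f (x k) - f (x (Suc k))) / rate) \<longlonglongrightarrow> 0"
    by simp
  have "(\<lambda>k. (norm (D k))\<^sup>2) \<longlonglongrightarrow> 0"
  proof (rule tendsto_sandwich[OF _ _ tendsto_const lim])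
    show "\<forall>\<^sub>F k in sequentially. (norm (D k))\<^sup>2 \<le> (f (x k) - f (x (Suc k))) / rate"
      using eventually_gt_at_top[of N]
    proof eventually_elim
      case (elim k)
      then show ?case
        using D(2)[of k] rate_pos by (simp add: pos_le_divide_eq mult.commute)
    qed
  qed auto
  then have "(\<lambda>k. sqrt ((norm (D k))\<^sup>2)) \<longlonglongrightarrow> sqrt 0"
    by (rule tendsto_real_sqrt)
  then show ?thesis
    by (simp add: tendsto_norm_zero_iff)
qed

section \<open>Stationarity of the accumulation point\<close>

lemma xs_in_box: "xs \<in> box_set l u"
  using closed_sequentially[of "box_set l u" "\<lambda>n. x (r n)" xs] x_in_box r(2)
  by (simp add: box_set_eq_cbox closed_cbox)

lemma xs_outside_I:
  assumes "i \<notin> I"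
  shows "xs $ i = 0"
proof -
  have "\<forall>\<^sub>F n in sequentially. x (r n) $ i = 0"
    using filterlim_iff[THEN iffD1, OF r_at_top, rule_format, OF eventually_gt_at_top[of N]]
    by eventually_elim (use assms x_outside_I in auto)
  then have "(\<lambda>n. x (r n) $ i) \<longlonglongrightarrow> 0"
    by (rule tendsto_eventually)
  moreover have "(\<lambda>n. x (r n) $ i) \<longlonglongrightarrow> xs $ i"
    by (intro tendsto_intros r)
  ultimately show ?thesis
    using LIMSEQ_unique by blast
qed

text \<open>The residual bound passes to the limit along \<open>r\<close>: the Hessians converge by
  continuity and the directions tend to 0.\<close>

lemma P_xs:
  assumes "i \<in> I"
  shows "P xs $ i = xs $ i"
proof -
  have lim: "(\<lambda>n. \<bar>P (x (r n)) $ i - x (r n) $ i\<bar>) \<longlonglongrightarrow> \<bar>P xs $ i - xs $ i\<bar>"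
    unfolding P_nth by (intro tendsto_intros r isCont_tendsto_compose[OF g_cont])
  have Dr: "(\<lambda>n. D (r n)) \<longlonglongrightarrow> 0"
    using filterlim_compose[OF D_tendsto_0 r_at_top] .
  have bound: "(\<lambda>n. \<bar>D (r n) $ i\<bar> + \<tau> * \<bar>(H (x (r n)) *v D (r n)) $ i\<bar>) \<longlonglongrightarrow>
      \<bar>0 $ i\<bar> + \<tau> * \<bar>(H xs *v 0) $ i\<bar>"
    unfolding matrix_vector_mult_def vec_lambda_beta
    by (intro tendsto_intros r Dr isCont_tendsto_compose[OF H_cont])
  have "\<forall>\<^sub>F n in sequentially. \<bar>P (x (r n)) $ i - x (r n) $ i\<bar> \<le> \<bar>D (r n) $ i\<bar> + \<tau> * \<bar>(H (x (r n)) *v D (r n)) $ i\<bar>"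
    using filterlim_iff[THEN iffD1, OF r_at_top, rule_format, OF eventually_gt_at_top[of N]]
    by eventually_elim (use assms D(3) in auto)
  from tendsto_le[OF _ bound lim this] show ?thesis
    by simp
qed

text \<open>The fixed-point property gives weak signs of the gradient; strict complementarity makes
  them strict at active bounds.\<close>

lemma xs_cases:
  assumes "i \<in> I"
  obtains "- l $ i < xs $ i" "xs $ i < u $ i" "g xs $ i = 0"
    | "xs $ i = u $ i" "g xs $ i < 0"
    | "xs $ i = - l $ i" "g xs $ i > 0"
proof -
  have sign: "- l $ j < xs $ j \<and> xs $ j < u $ j \<and> g xs $ j = 0 \<or> xs $ j = u $ j \<and> g xs $ j \<le> 0
      \<or> xs $ j = - l $ j \<and> g xs $ j \<ge> 0" if "j \<in> I" for j
    using clamp_fixpoint_sign[of "- l $ j" "u $ j" \<tau> "xs $ j" "g xs $ j"] P_xs[OF that]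
      l_pos[of j] u_pos[of j] \<tau>_pos by (simp add: P_nth)
  \<comment> \<open>Strict complementarity speaks about all multipliers, so some must be exhibited:
    the negative and positive parts of the gradient on \<open>I\<close>, and its negative
    outside.\<close>
  define \<xi> :: "real^'n" where "\<xi> = (\<chi> i. if i \<in> I then max 0 (- g xs $ i) else 0)"
  define b :: "real^'n" where "b = (\<chi> i. if i \<in> I then max 0 (g xs $ i) else 0)"
  define \<nu> :: "real^'n" where "\<nu> = (\<chi> i. if i \<in> I then 0 else - g xs $ i)"
  have "kkt_multipliers g l u I xs \<xi> b \<nu>"
    using sign by (force simp: kkt_multipliers_def vec_eq_iff \<xi>_def b_def \<nu>_def)
  then have "(xs $ i = u $ i \<longrightarrow> \<xi> $ i > 0) \<and> (xs $ i = - l $ i \<longrightarrow> b $ i > 0)"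
    using strict assms unfolding strict_complementarity_def by blast
  then show ?thesis
    using sign[OF assms] assms that by (auto simp: \<xi>_def b_def)
qed

lemma first_order:
  assumes "y \<in> box_set l u" "\<And>i. i \<notin> I \<Longrightarrow> y $ i = 0"
  shows "0 \<le> g xs \<bullet> (y - xs)"
  unfolding inner_vec_def
proof (rule sum_nonneg)
  fix i
  show "0 \<le> g xs $ i \<bullet> (y - xs) $ i"
  proof (cases "i \<in> I")
    case True
    have "- l $ i \<le> y $ i" "y $ i \<le> u $ i"
      using assms(1) by (auto simp: box_set_def)
    with True show ?thesis
      by (cases rule: xs_cases) (auto simp: mult_nonpos_nonpos)
  next
    case False
    then show ?thesis
      using assms(2) xs_outside_I by simp
  qed
qed

section \<open>Quadratic growth and trapping of the iterates\<close>

lemma quadratic_growth: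
  "\<forall>\<^sub>F y in nhds xs. y \<in> box_set l u \<longrightarrow> (\<forall>i. i \<notin> I \<longrightarrow> y $ i = 0) \<longrightarrow>
     f xs + ell / 2 * (norm (y - xs))\<^sup>2 \<le> f y"
proof -
  obtain U where U: "open U" "xs \<in> U"
    and conv: "\<And>y z. y \<in> U \<Longrightarrow> z \<in> U \<Longrightarrow> f z \<ge> f y + g y \<bullet> (z - y) + ell / 2 * (norm (z - y))\<^sup>2"
    using lsc by (auto simp: locally_strongly_convex_def)
  have "f xs + ell / 2 * (norm (y - xs))\<^sup>2 \<le> f y"
    if "y \<in> U" "y \<in> box_set l u" "\<forall>i. i \<notin> I \<longrightarrow> y $ i = 0" for y
    \<comment> \<open>Strong convexity is used with base point \<open>xs\<close>, where the linear
      term is nonnegative by \<open>first_order\<close>.\<close>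
    using conv[OF U(2) that(1)] first_order[of y] that by auto
  then show ?thesis
    using U by (auto simp: eventually_nhds)
qed

text \<open>
  Near \<open>xs\<close> the values \<open>f (x k)\<close> control the distance to \<open>xs\<close>, so an iterate that is close to
  \<open>xs\<close> at a late time cannot be carried away by the vanishing steps.
\<close>

lemma x_tendsto: "x \<longlonglongrightarrow> xs"
proof (rule metric_LIMSEQ_I)
  fix \<epsilon> :: real
  assume "\<epsilon> > 0"
  obtain \<rho>0 where "\<rho>0 > 0" and growth0: "\<And>y. dist y xs < \<rho>0 \<Longrightarrow> y \<in> box_set l u \<Longrightarrow>
      (\<forall>i. i \<notin> I \<longrightarrow> y $ i = 0) \<Longrightarrow> f xs + ell / 2 * (norm (y - xs))\<^sup>2 \<le> f y"
    using quadratic_growth unfolding eventually_nhds_metric by blast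
  define \<rho> where "\<rho> = min \<rho>0 \<epsilon>"
  have "\<rho> > 0"
    using \<open>\<rho>0 > 0\<close> \<open>\<epsilon> > 0\<close> by (simp add: \<rho>_def)
  have "\<forall>\<^sub>F k in sequentially. norm (D k) < \<rho> / 2"
    using D_tendsto_0 \<open>\<rho> > 0\<close> by (auto intro!: order_tendstoD(2)[where y = 0] tendsto_norm_zero)
  \<comment> \<open>The threshold is the growth bound at radius \<open>\<rho> / 2\<close>: an
    iterate in the growth region with a smaller value lies within \<open>\<rho> / 2\<close> of
    \<open>xs\<close>.\<close>
  moreover have "\<forall>\<^sub>F k in sequentially. f (x k) < f xs + ell / 2 * (\<rho> / 2)\<^sup>2"
    using ell_pos \<open>\<rho> > 0\<close> by (intro order_tendstoD(2)[OF f_limit]) simp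
  ultimately have "\<forall>\<^sub>F k in sequentially. k > N \<and> norm (D k) < \<rho> / 2 \<and> f (x k) < f xs + ell / 2 * (\<rho> / 2)\<^sup>2"
    using eventually_gt_at_top[of N] by eventually_elim auto
  then obtain K where K: "\<And>k. k \<ge> K \<Longrightarrow> k > N \<and> norm (D k) < \<rho> / 2 \<and> f (x k) < f xs + ell / 2 * (\<rho> / 2)\<^sup>2"
    by (auto simp: eventually_sequentially)
  have "\<forall>\<^sub>F n in sequentially. dist (x (r n)) xs < \<rho> / 2 \<and> n \<ge> K"
    using tendstoD[OF r(2), of "\<rho> / 2"] \<open>\<rho> > 0\<close> eventually_ge_at_top[of K]
    by (simp add: eventually_conj_iff)
  then obtain n where n: "dist (x (r n)) xs < \<rho> / 2" "n \<ge> K"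
    by (auto simp: eventually_sequentially)
  have "r n \<ge> K"
    using n(2) seq_suble[OF r(1), of n] by linarith
  have "dist (x k) xs < \<rho> / 2" if "k \<ge> r n" for k
    using that
  proof (induction k rule: dec_induct)
    case base
    show ?case using n by simp
  next
    case (step k)
    have k: "k \<ge> K" "Suc k \<ge> K"
      using step \<open>r n \<ge> K\<close> by auto
    \<comment> \<open>One step from the ball of radius \<open>\<rho> / 2\<close> stays inside radius
      \<open>\<rho>0\<close>, so growth applies and returns the iterate to the smaller ball.\<close>
    have "dist (x (Suc k)) (x k) < \<rho> / 2"
      using D(1)[of k] K[OF k(1)] by (auto simp: dist_norm)
    then have "dist (x (Suc k)) xs < \<rho>0"
      using step.IH dist_triangle[of "x (Suc k)" xs "x k"] by (simp add: \<rho>_def)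
    then have "f xs + ell / 2 * (norm (x (Suc k) - xs))\<^sup>2 \<le> f (x (Suc k))"
      using x_in_box x_outside_I K[OF k(2)] by (intro growth0) auto
    then have "ell / 2 * (norm (x (Suc k) - xs))\<^sup>2 < ell / 2 * (\<rho> / 2)\<^sup>2"
      using K[OF k(2)] by linarith
    then have "(norm (x (Suc k) - xs))\<^sup>2 < (\<rho> / 2)\<^sup>2"
      using ell_pos by (simp add: mult_less_cancel_left_pos)
    then show ?case
      using \<open>\<rho> > 0\<close> power_less_imp_less_base[of "norm (x (Suc k) - xs)" 2 "\<rho> / 2"]
      by (simp add: dist_norm)
  qed
  moreover have "\<rho> / 2 < \<epsilon>"
    using \<open>\<epsilon> > 0\<close> \<open>\<rho> > 0\<close> by (simp add: \<rho>_def min_def split: if_splits)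
  ultimately show "\<exists>k0. \<forall>k\<ge>k0. dist (x k) xs < \<epsilon>"
    by (meson less_trans)
qed

section \<open>Identification of the active bounds\<close>

text \<open>The free coordinates of the limit, which turn out to be the eventual
  \<open>\<Theta>\<close>.\<close>

definition "T = {i \<in> I. - l $ i < xs $ i \<and> xs $ i < u $ i}"

lemma shifted_tendsto:
  "(\<lambda>k. x k $ i - \<tau> * g (x k) $ i) \<longlonglongrightarrow> xs $ i - \<tau> * g xs $ i"
  by (intro tendsto_intros x_tendsto isCont_tendsto_compose[OF g_cont])

lemma g_xs_T: "i \<in> T \<Longrightarrow> g xs $ i = 0"
  using xs_cases[of i] by (auto simp: T_def)

text \<open>The strict sign of the gradient puts the shifted point strictly beyond the bound, an
  open condition that holds for late iterates too; the projection then returns the bound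
  itself.\<close>

lemma eventually_active:
  assumes "i \<in> I - T"
  shows "\<forall>\<^sub>F k in sequentially. i \<in> \<Gamma> (x k) \<and> P (x k) $ i = xs $ i"
proof -
  from assms have "i \<in> I" by simp
  then show ?thesis
  proof (cases rule: xs_cases)
    case 1
    then show ?thesis using assms by (simp add: T_def)
  next
    case 2
    then have "u $ i < xs $ i - \<tau> * g xs $ i"
      using \<tau>_pos by (simp add: mult_pos_neg)
    from order_tendstoD(1)[OF shifted_tendsto this] show ?thesis
      by eventually_elim (use 2 l_pos[of i] u_pos[of i] in \<open>auto simp: Gamma_set_def P_nth\<close>)
  next
    case 3
    then have "xs $ i - \<tau> * g xs $ i < - l $ i"
      using \<tau>_pos by simp
    from order_tendstoD(2)[OF shifted_tendsto this] show ?thesis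
      by eventually_elim (use 3 l_pos[of i] u_pos[of i] in \<open>auto simp: Gamma_set_def P_nth\<close>)
  qed
qed

lemma eventually_inactive:
  assumes "i \<in> T"
  shows "\<forall>\<^sub>F k in sequentially. i \<notin> \<Gamma> (x k)"
proof -
  have "- l $ i < xs $ i - \<tau> * g xs $ i" "xs $ i - \<tau> * g xs $ i < u $ i"
    using assms g_xs_T by (auto simp: T_def)
  from order_tendstoD(1)[OF shifted_tendsto this(1)] order_tendstoD(2)[OF shifted_tendsto this(2)]
  show ?thesis
    by eventually_elim (auto simp: Gamma_set_def)
qed

text \<open>Only \<open>\<Gamma>\<close> has to be located by continuity. The square-root threshold
  in \<open>\<Theta>\<close> is never checked near \<open>xs\<close>: as
  \<open>\<I> (x k) = I\<close> is known, \<open>\<Theta>\<close> is what \<open>\<Gamma>\<close>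
  leaves of \<open>I\<close>.\<close>

lemma identification:
  "\<forall>\<^sub>F k in sequentially. \<Theta> (x k) = T \<and> \<Gamma> (x k) = I - T \<and> (\<forall>i\<in>I - T. P (x k) $ i = xs $ i)"
proof -
  have "\<forall>\<^sub>F k in sequentially. \<forall>i\<in>I - T. i \<in> \<Gamma> (x k) \<and> P (x k) $ i = xs $ i"
    by (intro eventually_ball_finite ballI eventually_active) auto
  moreover have "\<forall>\<^sub>F k in sequentially. \<forall>i\<in>T. i \<notin> \<Gamma> (x k)"
    by (intro eventually_ball_finite ballI eventually_inactive) auto
  ultimately show ?thesis
    using eventually_ge_at_top[of N]
  proof eventually_elim
    case (elim k)
    have "\<Theta> (x k) \<union> \<Gamma> (x k) = I" "\<Theta> (x k) \<inter> \<Gamma> (x k) = {}"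
      using \<I>_eq[of k] elim Theta_Gamma_disjoint[of _ "x k"] by (auto simp: I_set_def)
    moreover have "T \<subseteq> I"
      by (auto simp: T_def)
    ultimately show ?case
      using elim by blast
  qed
qed

lemma eventually_fixed: "\<forall>\<^sub>F k in sequentially. \<forall>i. i \<notin> T \<longrightarrow> x k $ i = xs $ i"
proof -
  have "\<forall>\<^sub>F k in sequentially. \<forall>i. i \<notin> T \<longrightarrow> x (Suc k) $ i = xs $ i"
    using identification eventually_ge_at_top[of N]
  proof eventually_elim
    case (elim k)
    then show ?case
      using x_Gamma[of _ k] x_outside_I[of "Suc k"] xs_outside_I by (metis Diff_iff le_imp_less_Suc)
  qed
  then show ?thesis
    using eventually_sequentially_Suc[of "\<lambda>k. \<forall>i. i \<notin> T \<longrightarrow> x k $ i = xs $ i"] by simp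
qed

section \<open>Support of the limit and strict local minimality\<close>

lemma xs_nonzero:
  assumes "i \<in> I"
  shows "xs $ i \<noteq> 0"
proof (cases "i \<in> T")
  case True
  \<comment> \<open>On free coordinates the defining threshold of \<open>\<Theta>\<close> survives
    in the limit, and the gradient entry there is 0.\<close>
  have "\<forall>\<^sub>F k in sequentially. sqrt (2 * \<tau> * lam) \<le> \<bar>x k $ i - \<tau> * g (x k) $ i\<bar>"
    using identification by eventually_elim (use True in \<open>auto simp: Theta_set_def\<close>)
  from tendsto_lowerbound[OF tendsto_rabs[OF shifted_tendsto] this]
  have "sqrt (2 * \<tau> * lam) \<le> \<bar>xs $ i\<bar>"
    using g_xs_T[OF True] by simp
  moreover have "sqrt (2 * \<tau> * lam) > 0"
    using \<tau>_pos lam_pos by simp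
  ultimately show ?thesis by auto
next
  case False
  show ?thesis
    by (rule xs_cases[OF assms]) (use False assms l_pos[of i] u_pos[of i] in \<open>auto simp: T_def\<close>)
qed

lemma support_xs: "{i. xs $ i \<noteq> 0} = I"
  using xs_nonzero xs_outside_I by blast

lemma support_near_xs: "\<forall>\<^sub>F y in nhds xs. \<forall>i\<in>I. y $ i \<noteq> 0"
proof (intro eventually_ball_finite ballI)
  fix i assume "i \<in> I"
  have "((\<lambda>y. y $ i) \<longlongrightarrow> xs $ i) (nhds xs)"
    by (intro tendsto_vec_nth filterlim_ident)
  then show "\<forall>\<^sub>F y in nhds xs. y $ i \<noteq> 0"
    using xs_nonzero[OF \<open>i \<in> I\<close>] by (rule tendsto_imp_eventually_ne)
qed auto

lemma objective_box: "y \<in> box_set l u \<Longrightarrow> objective f lam l u y = ereal (f y + lam * real (l0norm y))"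
  by (simp add: objective_def penalty_def set_delta_def)

text \<open>Near \<open>xs\<close> no nonzero entry is lost. A feasible point with the same support
  is handled by quadratic growth; a larger support costs at least \<open>lam\<close>, while
  \<open>f\<close> drops by less than \<open>lam\<close> by continuity.\<close>

lemma strict_minimizer: "strict_local_minimizer (objective f lam l u) xs"
proof -
  have "\<forall>\<^sub>F y in nhds xs. f xs - lam < f y"
    using f_cont[of xs] lam_pos
    by (intro order_tendstoD(1)) (auto simp: isCont_def tendsto_at_iff_tendsto_nhds)
  then have "\<forall>\<^sub>F y in nhds xs. y \<noteq> xs \<longrightarrow> objective f lam l u xs < objective f lam l u y"
    using quadratic_growth support_near_xs
  proof eventually_elim
    case (elim y)
    show ?case
    proof
      assume "y \<noteq> xs"
      show "objective f lam l u xs < objective f lam l u y"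
      proof (cases "y \<in> box_set l u")
        case False
        then have "objective f lam l u y = \<infinity>"
          using lam_pos by (simp add: objective_def penalty_def set_delta_def)
        then show ?thesis
          using xs_in_box by (simp add: objective_box)
      next
        case True
        have sub: "I \<subseteq> {i. y $ i \<noteq> 0}"
          using elim by auto
        have "f xs + lam * real (card I) < f y + lam * real (l0norm y)"
        proof (cases "I = {i. y $ i \<noteq> 0}")
          case I: True
          then have "\<forall>i. i \<notin> I \<longrightarrow> y $ i = 0"
            by blast
          then have "f xs + ell / 2 * (norm (y - xs))\<^sup>2 \<le> f y"
            using elim True by blast
          moreover have "ell / 2 * (norm (y - xs))\<^sup>2 > 0"
            using \<open>y \<noteq> xs\<close> ell_pos by simp
          ultimately show ?thesis
            by (simp add: l0norm_def I[symmetric])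
        next
          case False
          then have "card I < l0norm y"
            unfolding l0norm_def using sub by (intro psubset_card_mono) auto
          then have "lam * (real (card I) + 1) \<le> lam * real (l0norm y)"
            using lam_pos by (intro mult_left_mono) auto
          then show ?thesis
            using elim by (simp add: algebra_simps)
        qed
        then show ?thesis
          using True xs_in_box support_xs by (simp add: objective_box l0norm_def)
      qed
    qed
  qed
  then show ?thesis
    by (auto simp: strict_local_minimizer_def eventually_nhds_metric dist_commute)
qed

section \<open>The Newton phase\<close>

text \<open>Bounds the norm of every solution of the Newton system.\<close>

definition "\<omega> k = (\<Sum>i\<in>T. \<bar>g (x k) $ i\<bar>) / ell"

lemma omega_tendsto_0: "\<omega> \<longlonglongrightarrow> 0"
proof -
  have "\<omega> \<longlonglongrightarrow> (\<Sum>i\<in>T. \<bar>g xs $ i\<bar>) / ell"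
    unfolding \<omega>_def using ell_pos
    by (intro tendsto_intros isCont_tendsto_compose[OF g_cont] x_tendsto) auto
  then show ?thesis
    by (simp add: g_xs_T)
qed

text \<open>Everything that makes iteration k a Newton step in the free coordinates alone. The last
  clause leaves room in the box for any direction of norm at most \<open>\<omega> k\<close>.\<close>

definition regime :: "nat \<Rightarrow> bool" where
  "regime k \<longleftrightarrow> k > N \<and> \<Theta> (x k) = T \<and> \<Gamma> (x k) = I - T \<and> (\<forall>i\<in>I - T. P (x k) $ i = xs $ i) \<and>
     (\<forall>i. i \<notin> T \<longrightarrow> x k $ i = xs $ i) \<and> (\<forall>i\<in>I. x k $ i \<noteq> 0) \<and>
     (\<forall>v. ell * (norm v)\<^sup>2 \<le> v \<bullet> (H (x k) *v v)) \<and>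
     (\<forall>i\<in>T. - l $ i < x k $ i - \<omega> k \<and> x k $ i + \<omega> k < u $ i)"

lemma eventually_regime: "\<forall>\<^sub>F k in sequentially. regime k"
proof -
  have "\<forall>\<^sub>F k in sequentially. \<forall>i\<in>T. - l $ i < x k $ i - \<omega> k \<and> x k $ i + \<omega> k < u $ i"
  proof (intro eventually_ball_finite ballI eventually_conj)
    fix i assume "i \<in> T"
    have "(\<lambda>k. x k $ i - \<omega> k) \<longlonglongrightarrow> xs $ i - 0" "(\<lambda>k. x k $ i + \<omega> k) \<longlonglongrightarrow> xs $ i + 0"
      by (intro tendsto_intros x_tendsto omega_tendsto_0)+
    then show "\<forall>\<^sub>F k in sequentially. - l $ i < x k $ i - \<omega> k" "\<forall>\<^sub>F k in sequentially. x k $ i + \<omega> k < u $ i"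
      using \<open>i \<in> T\<close> by (auto intro: order_tendstoD simp: T_def)
  qed auto
  with identification eventually_fixed eventually_gt_at_top[of N]
    eventually_compose_filterlim[OF support_near_xs x_tendsto]
    eventually_compose_filterlim[OF locally_strongly_convex_hessian[OF C2 lsc] x_tendsto]
  show ?thesis
    unfolding regime_def by eventually_elim blast
qed

section \<open>A single iteration in the regime\<close>

lemma inner_T_eq:
  assumes "\<And>i. i \<notin> T \<Longrightarrow> v $ i = 0" "\<And>i. i \<in> T \<Longrightarrow> a $ i = b $ i"
  shows "v \<bullet> a = v \<bullet> b"
  unfolding inner_vec_def
proof (rule sum.cong[OF refl])
  fix i
  show "v $ i \<bullet> a $ i = v $ i \<bullet> b $ i"
    using assms by (cases "i \<in> T") simp_all
qed

context
  fixes k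
  assumes reg: "regime k"
begin

lemma regime_I: "\<I> (x k) = I" "prev k = I"
proof -
  have "k > N"
    using reg by (simp add: regime_def)
  then show "\<I> (x k) = I" "prev k = I"
    by (auto intro!: \<I>_eq)
qed

text \<open>Off \<open>T\<close> the iterate already sits at its projection target or at 0, so the
  prescribed entries of \<open>d\<close> vanish.\<close>

lemma regime_newton_iff:
  "newton_system g H l u lam \<tau> (x k) d \<longleftrightarrow>
     (\<forall>i\<in>T. (H (x k) *v d) $ i = - g (x k) $ i) \<and> (\<forall>i. i \<notin> T \<longrightarrow> d $ i = 0)"
proof -
  have "T \<subseteq> I"
    by (auto simp: T_def)
  moreover have "x k $ i = 0" if "i \<notin> I" for i
    using that x_outside_I reg by (simp add: regime_def)
  ultimately show ?thesis
    using reg unfolding newton_system_alt regime_I regime_def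
    by (smt (verit) Compl_iff Diff_iff subsetD)
qed

text \<open>Taking Hessian rows on \<open>T\<close> and identity rows elsewhere gives a square
  linear map; positive definiteness makes it injective, hence surjective.\<close>

lemma regime_solvable: "\<exists>d. newton_system g H l u lam \<tau> (x k) d"
proof -
  define A where "A v = (\<chi> i. if i \<in> T then (H (x k) *v v) $ i else v $ i)" for v
  have "linear A"
    by (rule linearI) (auto simp: A_def vec_eq_iff matrix_vector_right_distrib matrix_vector_mult_scaleR)
  moreover have "inj A"
    unfolding linear_injective_0[OF \<open>linear A\<close>]
  proof (intro allI impI)
    fix v assume "A v = 0"
    then have "\<And>i. i \<in> T \<Longrightarrow> (H (x k) *v v) $ i = 0" "\<And>i. i \<notin> T \<Longrightarrow> v $ i = 0"
      by (auto simp: A_def vec_eq_iff split: if_splits)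
    then have "v \<bullet> (H (x k) *v v) = v \<bullet> 0"
      by (intro inner_T_eq) auto
    then have "ell * (norm v)\<^sup>2 \<le> 0"
      using reg by (metis regime_def inner_zero_right)
    then show "v = 0"
      using ell_pos by (simp add: mult_le_0_iff)
  qed
  ultimately have "surj A"
    by (rule linear_injective_imp_surjective) simp
  then obtain d where d: "A d = (\<chi> i. if i \<in> T then - g (x k) $ i else 0)"
    by (metis surjD)
  have "(H (x k) *v d) $ i = - g (x k) $ i" if "i \<in> T" for i
    using arg_cong[OF d, of "\<lambda>v. v $ i"] that by (simp add: A_def)
  moreover have "d $ i = 0" if "i \<notin> T" for i
    using arg_cong[OF d, of "\<lambda>v. v $ i"] that by (simp add: A_def)
  ultimately show ?thesis
    unfolding regime_newton_iff by blast
qed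

context
  fixes d
  assumes sys: "newton_system g H l u lam \<tau> (x k) d"
begin

text \<open>Pairing the Newton equations with \<open>d\<close>, which is supported on
  \<open>T\<close>, gives the identity. The Hessian bound then yields the descent estimate, and
  cancelling one factor \<open>norm d\<close> the norm bound.\<close>

lemma regime_direction:
  shows "d \<bullet> (H (x k) *v d) = - (g (x k) \<bullet> d)"
    and "ell * (norm d)\<^sup>2 \<le> - (g (x k) \<bullet> d)"
    and "norm d \<le> \<omega> k"
proof -
  note d = sys[unfolded regime_newton_iff]
  have "d \<bullet> (H (x k) *v d) = d \<bullet> (- g (x k))"
    using d by (intro inner_T_eq) auto
  then show 1: "d \<bullet> (H (x k) *v d) = - (g (x k) \<bullet> d)"
    by (simp add: inner_commute)
  then show 2: "ell * (norm d)\<^sup>2 \<le> - (g (x k) \<bullet> d)"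
    using reg by (metis regime_def)
  have "- (g (x k) \<bullet> d) = (\<Sum>i\<in>T. - (g (x k) $ i * d $ i))"
    unfolding inner_vec_def inner_real_def sum_negf[symmetric] using d
    by (intro sum.mono_neutral_right) auto
  also have "\<dots> \<le> (\<Sum>i\<in>T. \<bar>g (x k) $ i\<bar> * norm d)"
  proof (rule sum_mono)
    fix i
    have "- (g (x k) $ i * d $ i) \<le> \<bar>g (x k) $ i\<bar> * \<bar>d $ i\<bar>"
      by (metis abs_ge_minus_self abs_mult)
    also have "\<dots> \<le> \<bar>g (x k) $ i\<bar> * norm d"
      by (intro mult_left_mono component_le_norm_cart) auto
    finally show "- (g (x k) $ i * d $ i) \<le> \<bar>g (x k) $ i\<bar> * norm d" .
  qed
  also have "\<dots> = ell * \<omega> k * norm d"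
    using ell_pos by (simp add: \<omega>_def sum_distrib_right)
  finally have "norm d * (ell * norm d) \<le> norm d * (ell * \<omega> k)"
    using 2 by (simp add: power2_eq_square mult_ac)
  moreover have "0 \<le> \<omega> k"
    using ell_pos by (auto simp: \<omega>_def intro: sum_nonneg)
  ultimately show "norm d \<le> \<omega> k"
    using ell_pos by (cases "d = 0") simp_all
qed

text \<open>Descent follows from \<delta> < \<open>ell\<close>, the cardinality test from nonzero
  entries on \<open>I\<close>, feasibility from the margin \<open>\<omega> k\<close>, and the index
  test from \<open>prev k = I\<close>.\<close>

lemma regime_accepted: "newton_accepted g l u lam \<tau> \<delta> (prev k) (x k) d"
proof -
  note d = sys[unfolded regime_newton_iff]
  have "T \<subseteq> I"
    by (auto simp: T_def)
  have "(\<Sum>i\<in>I. g (x k) $ i * d $ i) = g (x k) \<bullet> d"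
    unfolding inner_vec_def inner_real_def using d \<open>T \<subseteq> I\<close>
    by (intro sum.mono_neutral_left) auto
  also have "\<dots> \<le> - (ell * (norm d)\<^sup>2)"
    using regime_direction(2) by simp
  also have "\<dots> \<le> - \<delta> * (norm d)\<^sup>2"
    using \<delta>_less by (simp add: mult_right_mono)
  moreover have "0 \<le> (\<Sum>i\<in>- I. (x k $ i)\<^sup>2) / (4 * \<tau>)"
    using \<tau>_pos by (simp add: sum_nonneg)
  ultimately have "(\<Sum>i\<in>I. g (x k) $ i * d $ i) \<le> - \<delta> * (norm d)\<^sup>2 + (\<Sum>i\<in>- I. (x k $ i)\<^sup>2) / (4 * \<tau>)"
    by linarith
  moreover have "card I \<le> l0norm (x k)"
    unfolding l0norm_def using reg by (intro card_mono) (auto simp: regime_def)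
  moreover have "x k + d \<in> box_set l u"
  proof -
    have "- l $ i \<le> (x k + d) $ i \<and> (x k + d) $ i \<le> u $ i" for i
    proof (cases "i \<in> T")
      case True
      then have "- l $ i < x k $ i - \<omega> k" "x k $ i + \<omega> k < u $ i"
        using reg by (auto simp: regime_def)
      then show ?thesis
        using component_le_norm_cart[of d i] regime_direction(3) by auto
    next
      case False
      then show ?thesis
        using d x_in_box[of k] by (simp add: box_set_def)
    qed
    then show ?thesis
      by (simp add: box_set_def)
  qed
  ultimately show ?thesis
    unfolding newton_accepted_def Let_def regime_I by blast
qed

lemma regime_trial_point: "trial_point g l u lam \<tau> (x k) d 1 = x k + d"
proof -
  have "x k $ i = 0" "d $ i = 0" if "i \<notin> I" for i
    using that x_outside_I reg sys by (auto simp: regime_def regime_newton_iff T_def)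
  then show ?thesis
    using reg by (auto simp: trial_point_def vec_eq_iff regime_def)
qed

end

lemma regime_newton: "nm k"
  using regime_solvable regime_accepted newton_forced by blast

section \<open>Unit step and quadratic rate under a Lipschitz Hessian\<close>

context
  fixes U M
  assumes convU: "convex U" and xsU: "xs \<in> U" and xU: "x k \<in> U"
    and nearU: "\<And>d. norm d \<le> \<omega> k \<Longrightarrow> x k + d \<in> U"
    and M: "M \<ge> 0" "M * \<omega> k \<le> (1 - 2 * \<sigma>) * ell"
    and lip: "\<And>y z. y \<in> U \<Longrightarrow> z \<in> U \<Longrightarrow> onorm (\<lambda>v. (H y - H z) *v v) \<le> M * norm (y - z)"
begin

text \<open>By the Newton equations the second-order model decreases by half of
  \<open>- (g (x k) \<bullet> d)\<close>. Armijo asks only for the fraction \<sigma>, and the slack,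
  at least (1/2 - \<sigma>) \<open>ell\<close> times the squared norm of \<open>d\<close>, absorbs
  the cubic remainder.\<close>

lemma regime_unit_step:
  assumes sys: "newton_system g H l u lam \<tau> (x k) d"
  shows "armijo f g l u lam \<tau> \<sigma> (x k) d 1"
proof -
  define B where "B = M / 2 * (norm d)\<^sup>2 * norm d"
  have "f (x k + d) \<le> f (x k) + g (x k) \<bullet> d + (d \<bullet> (H (x k) *v d)) / 2 + B"
  proof (rule taylor_upper_bound[OF C2])
    fix t :: real
    assume t: "0 \<le> t" "t \<le> 1"
    then have td: "norm (t *\<^sub>R d) \<le> norm d"
      by (simp add: mult_left_le_one_le)
    have "d \<bullet> (g (x k + t *\<^sub>R d) - g (x k) - H (x k) *v (t *\<^sub>R d)) \<le> M / 2 * (norm (t *\<^sub>R d))\<^sup>2 * norm d"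
      using lipschitz_hessian_gradient_bound[OF C2 convU lip xU nearU[of "t *\<^sub>R d"] M(1), of d]
        td regime_direction(3)[OF sys] by simp
    also have "\<dots> \<le> B"
      unfolding B_def using td M(1) by (intro mult_right_mono mult_left_mono power_mono) auto
    finally show "d \<bullet> (g (x k + t *\<^sub>R d) - g (x k) - H (x k) *v (t *\<^sub>R d)) \<le> B" .
  qed
  moreover have "B \<le> - ((1 / 2 - \<sigma>) * (g (x k) \<bullet> d))"
  proof -
    have "B = (norm d)\<^sup>2 / 2 * (M * norm d)"
      by (simp add: B_def)
    also have "\<dots> \<le> (norm d)\<^sup>2 / 2 * ((1 - 2 * \<sigma>) * ell)"
      using M mult_left_mono[OF regime_direction(3)[OF sys] M(1)] by (intro mult_left_mono) auto
    also have "\<dots> = (1 / 2 - \<sigma>) * (ell * (norm d)\<^sup>2)"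
      by (simp add: field_simps)
    also have "\<dots> \<le> (1 / 2 - \<sigma>) * - (g (x k) \<bullet> d)"
      using regime_direction(2)[OF sys] \<sigma> by (intro mult_left_mono) auto
    finally show ?thesis by simp
  qed
  ultimately have "f (x k + d) \<le> f (x k) + \<sigma> * (g (x k) \<bullet> d)"
    using regime_direction(1)[OF sys] by (simp add: left_diff_distrib)
  then show ?thesis
    by (simp add: armijo_def regime_trial_point[OF sys])
qed

lemma regime_quadratic: "norm (x (Suc k) - xs) \<le> M / (2 * ell) * (norm (x k - xs))\<^sup>2"
proof -
  obtain d m where sys: "newton_system g H l u lam \<tau> (x k) d"
    and fails: "\<And>j. j < m \<Longrightarrow> \<not> armijo f g l u lam \<tau> \<sigma> (x k) d (\<beta> ^ j)"
    and x': "x (Suc k) = trial_point g l u lam \<tau> (x k) d (\<beta> ^ m)"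
    using newton_stepE[OF regime_newton] by metis
  have "m = 0"
    using fails[of 0] regime_unit_step[OF sys] by (cases m) auto
  define e where "e = x (Suc k) - xs"
  have e: "e = x k + d - xs"
    by (simp add: e_def x' \<open>m = 0\<close> regime_trial_point[OF sys])
  note d = sys[unfolded regime_newton_iff]
  have "ell * (norm e)\<^sup>2 \<le> e \<bullet> (H (x k) *v e)"
    using reg by (simp add: regime_def)
  \<comment> \<open>On rows in \<open>T\<close> the Newton equation replaces
    \<open>H (x k) *v d\<close> by the negative gradient, and \<open>g xs\<close> vanishes there.
    What remains is the linearization error of the gradient between \<open>x k\<close> and
    \<open>xs\<close>.\<close>
  also have "\<dots> = e \<bullet> (g xs - g (x k) - H (x k) *v (xs - x k))"
  proof (rule inner_T_eq)
    show "e $ i = 0" if "i \<notin> T" for i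
      using that d reg by (simp add: e regime_def)
    show "(H (x k) *v e) $ i = (g xs - g (x k) - H (x k) *v (xs - x k)) $ i" if "i \<in> T" for i
      using that d g_xs_T[of i] by (simp add: e matrix_vector_right_distrib matrix_vector_mult_diff_distrib)
  qed
  also have "\<dots> \<le> M / 2 * (norm (xs - x k))\<^sup>2 * norm e"
    using lipschitz_hessian_gradient_bound[OF C2 convU lip xU xsU M(1)] .
  finally have "norm e * (ell * norm e) \<le> norm e * (M / 2 * (norm (x k - xs))\<^sup>2)"
    by (simp add: power2_eq_square mult_ac norm_minus_commute)
  then have "ell * norm e \<le> M / 2 * (norm (x k - xs))\<^sup>2"
    using M(1) by (cases "e = 0") simp_all
  then show ?thesis
    using ell_pos by (simp add: e_def field_simps)
qed

end

end

lemma eventually_newton: "\<forall>\<^sub>F k in sequentially. nm k"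
  using eventually_regime by eventually_elim (rule regime_newton)

lemma eventually_quadratic:
  assumes "M \<ge> 0" "hessian_locally_lipschitz H xs M"
  shows "\<forall>\<^sub>F k in sequentially. norm (x (Suc k) - xs) \<le> M / (2 * ell) * (norm (x k - xs))\<^sup>2"
proof -
  obtain V where V: "open V" "xs \<in> V"
    and lipV: "\<And>y z. y \<in> V \<Longrightarrow> z \<in> V \<Longrightarrow> onorm (\<lambda>v. (H y - H z) *v v) \<le> M * norm (y - z)"
    using assms(2) by (auto simp: hessian_locally_lipschitz_def)
  \<comment> \<open>A ball supplies convexity; half of its radius is reserved for the distance of
    \<open>x k\<close> to \<open>xs\<close>, half for the direction.\<close>
  obtain e where "e > 0" and sub: "ball xs e \<subseteq> V"
    using openE[OF V] .
  have "\<forall>\<^sub>F k in sequentially. dist (x k) xs < e / 2"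
    using tendstoD[OF x_tendsto, of "e / 2"] \<open>e > 0\<close> by simp
  moreover have "\<forall>\<^sub>F k in sequentially. \<omega> k < e / 2"
    using order_tendstoD(2)[OF omega_tendsto_0, of "e / 2"] \<open>e > 0\<close> by simp
  moreover have "\<forall>\<^sub>F k in sequentially. M * \<omega> k < (1 - 2 * \<sigma>) * ell"
    using tendsto_mult_right_zero[OF omega_tendsto_0, of M] \<sigma> ell_pos by (intro order_tendstoD(2)) auto
  ultimately show ?thesis
    using eventually_regime
  proof eventually_elim
    case (elim k)
    have lip: "onorm (\<lambda>v. (H y - H z) *v v) \<le> M * norm (y - z)"
      if "y \<in> ball xs e" "z \<in> ball xs e" for y z
      using that sub by (intro lipV) auto
    show ?case
    proof (rule regime_quadratic[OF elim(4), where U = "ball xs e"])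
      fix d :: "real^'n"
      assume "norm d \<le> \<omega> k"
      then show "x k + d \<in> ball xs e"
        using elim norm_triangle_ineq[of "x k - xs" d]
        by (simp add: dist_norm norm_minus_commute[of xs] add_diff_eq diff_add_eq)
    qed (use elim \<open>e > 0\<close> assms(1) lip in \<open>auto simp: dist_commute\<close>)
  qed
qed

end

section \<open>From the parameter conditions to the convergence results\<close>

theorem theorem7:
  fixes f :: "real^'n \<Rightarrow> real"
    and g :: "real^'n \<Rightarrow> real^'n"
    and H :: "real^'n \<Rightarrow> real^'n^'n"
    and l u xs :: "real^'n"
    and lam \<tau> \<delta> \<sigma> \<beta> L ell :: real
    and x :: "nat \<Rightarrow> real^'n"
    and nm :: "nat \<Rightarrow> bool"
    and I_inf :: "'n set"
  assumes "twice_cont_diff f g H"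
    and "bdd_below (range f)"
    and "g 0 \<noteq> 0"
    and "\<forall>i. l $ i \<ge> 0" and "\<forall>i. u $ i \<ge> 0"
    and "0 < \<sigma>" and "\<sigma> < 1 / 2"
    and "0 < \<beta>" and "\<beta> < 1"
    and "L > 0" and "ell > 0"
    and "0 < \<delta>" and "\<delta> < min 1 ell"
    and "0 < lam" and "lam < lam_lower g \<tau>"
    and "0 < \<tau>" and "\<tau> < a_const l u / (2 * lam)"
    and "\<tau> < tau_bar g l u lam \<sigma> \<beta> \<delta> L"
    and "bnl0r_run f g H l u lam \<tau> \<delta> \<sigma> \<beta> x nm"
    and "accumulation_point x xs"
    and "\<forall>\<^sub>F k in sequentially. I_set g l u lam \<tau> (x k) = I_inf"
    and "strict_complementarity g l u I_inf xs"
    and "abadie_cq l u I_inf xs"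
    and "strongly_smooth f g L"
    and "locally_strongly_convex f g xs ell"
  shows "(x \<longlonglongrightarrow> xs \<and> strict_local_minimizer (objective f lam l u) xs) \<and>
         (\<forall>\<^sub>F k in sequentially. nm k) \<and>
         (\<forall>M\<ge>0. hessian_locally_lipschitz H xs M \<longrightarrow>
            (\<forall>\<^sub>F k in sequentially.
               norm (x (Suc k) - xs) \<le> M / (2 * min 1 ell) * (norm (x k - xs))\<^sup>2))"
proof -
  \<comment> \<open>The bounds are assumed only nonnegative; 0 < \<tau> < a / (2 \<open>lam\<close>)
    forces a > 0, which makes every bound strictly positive.\<close>
  have a_pos: "a_const l u > 0"
  proof -
    have "0 < a_const l u / (2 * lam)"
      using assms(16,17) by linarith
    then show ?thesis
      using \<open>0 < lam\<close> by (simp add: zero_less_divide_iff)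
  qed
  have bounds: "l $ i > 0" "u $ i > 0" for i
  proof -
    have "a_const l u \<le> min ((l $ i)\<^sup>2) ((u $ i)\<^sup>2)"
      unfolding a_const_def by (intro Min_le) auto
    then have "0 < (l $ i)\<^sup>2" "0 < (u $ i)\<^sup>2"
      using a_pos by linarith+
    then show "l $ i > 0" "u $ i > 0"
      using assms(4,5) by (auto simp: less_le)
  qed
  have "tau_bar g l u lam \<sigma> \<beta> \<delta> L \<le> 1 / (4 * L)"
    unfolding tau_bar_def by (intro Min_le) auto
  then have \<tau>_less: "\<tau> < 1 / (4 * L)"
    using assms(18) by linarith
  obtain N where N: "\<And>k. k \<ge> N \<Longrightarrow> I_set g l u lam \<tau> (x k) = I_inf"
    using assms(21) by (auto simp: eventually_sequentially)
  interpret bnl0r_limit f g H l u lam \<tau> \<delta> \<sigma> \<beta> L x nm ell I_inf N xs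
    using assms bounds \<tau>_less N by unfold_locales auto
  have "\<forall>\<^sub>F k in sequentially. norm (x (Suc k) - xs) \<le> M / (2 * min 1 ell) * (norm (x k - xs))\<^sup>2"
    if "M \<ge> 0" "hessian_locally_lipschitz H xs M" for M
    using eventually_quadratic[OF that]
  proof eventually_elim
    case (elim k)
    \<comment> \<open>The rate obtained has the constant \<open>ell\<close>; shrinking the
      denominator to \<open>min 1 ell\<close> weakens it to the stated form.\<close>
    also have "M / (2 * ell) * (norm (x k - xs))\<^sup>2 \<le> M / (2 * min 1 ell) * (norm (x k - xs))\<^sup>2"
      using that(1) \<open>ell > 0\<close> by (intro mult_right_mono divide_left_mono) auto
    finally show ?case .
  qed
  then show ?thesis
    using x_tendsto strict_minimizer eventually_newton by blast
qed

end
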